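(* Let $n\geq 1$ be an integer. Then $\mathbf{PA}_n\subseteq\mathbf{R}^{n+1}$ is a simple $n$-dimensional polytope that realises the simplicial complex $C$; that is, the semilattice obtained by removing the bottom element (the empty face) from the face lattice of $\mathbf{PA}_n$ is isomorphic, as a partially ordered set, to $(C,\supseteq)$.
   Context: Fix an integer $n\geq 1$ and let $X=\{0,\ldots,n\}$. A simplicial complex is a non-empty finite collection of finite sets closed under taking subsets (so it contains $\emptyset$). $\mathcal{P}(S)$ denotes the power set of $S$. For a family of sets $N$, an $N$-antichain is a subset $\{X_1,\ldots,X_m\}\subseteq N$ with $m\geq 2$ whose members are mutually incomparable with respect to $\subseteq$. Let $C_0=\mathcal{P}(X)-\{X\}$ and $\mathcal{B}_0=C_0-\{\emptyset\}$. A set $N\subseteq\mathcal{B}_0$ is 0-nested when the union of every $N$-antichain belongs to $C_0-\mathcal{B}_0=\{\emptyset\}$; equivalently, every two members of $N$ are comparable with respect to $\subseteq$. Let $C_1$ be the simplicial complex of all 0-nested sets. Let $\mathcal{B}_1\subseteq C_1$ be the family of all sets of the form $$\bigl\{\{i_{k+l},\ldots,i_k,\ldots,i_1\},\ldots,\{i_{k+l},\ldots,i_k,i_{k-1}\},\{i_{k+l},\ldots,i_k\}\bigr\},$$ where $1\leq k\leq k+l\leq n$ and $i_1,\ldots,i_{k+l}$ are mutually distinct elements of $X$ (i.e. the $k$ sets $\{i_j,i_{j+1},\ldots,i_{k+l}\}$, $1\leq j\leq k$). A set $N\subseteq\mathcal{B}_1$ is 1-nested when the union of every $N$-antichain belongs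 to $C_1-\mathcal{B}_1$ (here the union of the members of the antichain, each of which is a set of subsets of $X$). Let $C$ be the simplicial complex of all 1-nested sets. For $1\leq k\leq k+l\leq n$ let $$\kappa(k,l)=\frac{3^{k+l+1}-3^{l+1}}{2}+\frac{3^k-3k}{3^n-n-1}.$$ For an element $\beta\in\mathcal{B}_1$ of the form displayed above, let $\beta^{\geq}$ be the halfspace in $\mathbf{R}^{n+1}$ (with coordinates $x_0,\ldots,x_n$) given by $$x_{i_1}+2x_{i_2}+\ldots+(k-1)x_{i_{k-1}}+k(x_{i_k}+\ldots+x_{i_{k+l}})\geq\kappa(k,l).$$ Let $\pi$ be the hyperplane $x_0+\ldots+x_n=3^{n+1}$ in $\mathbf{R}^{n+1}$ and let $$\mathbf{PA}_n=\Bigl(\bigcap\{\beta^{\geq}\mid\beta\in\mathcal{B}_1\}\Bigr)\cap\pi.$$ *)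

theory Defs
  imports "HOL-Analysis.Analysis"
begin

text \<open>
  The ground set \<open>X = {0, \<dots>, n}\<close> is represented by a finite type \<open>'m\<close> with \<open>CARD('m) = n + 1\<close>,
  which also indexes the coordinates, i.e. \<open>X\<close> is \<open>UNIV :: 'm set\<close> and
  points of the ambient space have type \<open>real ^ 'm\<close>.  The integer \<open>n\<close> is passed explicitly.
\<close>

definition antichain_in :: "'a set set \<Rightarrow> 'a set set \<Rightarrow> bool" where
  "antichain_in N A \<longleftrightarrow> A \<subseteq> N \<and> finite A \<and> card A \<ge> 2 \<and>
     (\<forall>S\<in>A. \<forall>T\<in>A. S \<noteq> T \<longrightarrow> \<not> S \<subseteq> T)"

text \<open>The common pattern of 0-nestedness and 1-nestedness, for a building set \<open>B\<close> of \<open>K\<close>.\<close>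

definition nested :: "'a set set \<Rightarrow> 'a set set \<Rightarrow> 'a set set \<Rightarrow> bool" where
  "nested K B N \<longleftrightarrow> N \<subseteq> B \<and> (\<forall>A. antichain_in N A \<longrightarrow> \<Union>A \<in> K - B)"

definition C0 :: "'m set set" where
  "C0 = Pow UNIV - {UNIV}"

definition B0 :: "'m set set" where
  "B0 = C0 - {{}}"

definition C1 :: "'m set set set" where
  "C1 = {N. nested C0 B0 N}"

text \<open>A sequence of distinct elements \<open>i\<^sub>1, \<dots>, i\<^bsub>k+l\<^esub>\<close> is the restriction to \<open>{1..k+l}\<close> of
  a function \<open>i\<close>; values of \<open>i\<close> outside this interval are irrelevant.\<close>

definition admissible :: "nat \<Rightarrow> nat \<Rightarrow> nat \<Rightarrow> (nat \<Rightarrow> 'm) \<Rightarrow> bool" where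
  "admissible n k l i \<longleftrightarrow> 1 \<le> k \<and> k + l \<le> n \<and> inj_on i {1..k + l}"

definition tail_chain :: "nat \<Rightarrow> nat \<Rightarrow> (nat \<Rightarrow> 'm) \<Rightarrow> 'm set set" where
  "tail_chain k l i = {i ` {j..k + l} | j. 1 \<le> j \<and> j \<le> k}"

definition B1 :: "nat \<Rightarrow> 'm set set set" where
  "B1 n = {tail_chain k l i | k l i. admissible n k l i}"

definition C :: "nat \<Rightarrow> 'm set set set set" where
  "C n = {N. nested C1 (B1 n) N}"

definition kappa :: "nat \<Rightarrow> nat \<Rightarrow> nat \<Rightarrow> real" where
  "kappa n k l = (3 ^ (k + l + 1) - 3 ^ (l + 1)) / 2
     + (3 ^ k - 3 * real k) / (3 ^ n - real n - 1)"

definition chain_ineq :: "nat \<Rightarrow> nat \<Rightarrow> nat \<Rightarrow> (nat \<Rightarrow> 'm::finite) \<Rightarrow> real ^ 'm \<Rightarrow> bool" where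
  "chain_ineq n k l i x \<longleftrightarrow>
     (\<Sum>j = 1..<k. real j * x $ i j) + real k * (\<Sum>j = k..k + l. x $ i j) \<ge> kappa n k l"

text \<open>An element of \<open>B1 n\<close> has several presentations \<open>tail_chain k l i\<close> (the elements
  \<open>i\<^sub>k, \<dots>, i\<^bsub>k+l\<^esub>\<close> may be permuted).  They all give the same inequality, see
  \<open>halfspace_tail_chain\<close> below, so quantifying over all of them is harmless.\<close>

definition halfspace :: "nat \<Rightarrow> 'm::finite set set \<Rightarrow> (real ^ 'm) set" where
  "halfspace n \<beta> =
     {x. \<forall>k l i. admissible n k l i \<and> \<beta> = tail_chain k l i \<longrightarrow> chain_ineq n k l i x}"

definition PA :: "nat \<Rightarrow> (real ^ 'm::finite) set" where
  "PA n = (\<Inter>\<beta>\<in>B1 n. halfspace n \<beta>) \<inter> {x. (\<Sum>v\<in>UNIV. x $ v) = 3 ^ (n + 1)}"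

definition simple_polytope :: "'a::euclidean_space set \<Rightarrow> bool" where
  "simple_polytope P \<longleftrightarrow> polytope P \<and>
     (\<forall>v. v extreme_point_of P \<longrightarrow> int (card {F. F facet_of P \<and> v \<in> F}) = aff_dim P)"

definition order_isomorphic ::
    "'a set \<Rightarrow> ('a \<Rightarrow> 'a \<Rightarrow> bool) \<Rightarrow> 'b set \<Rightarrow> ('b \<Rightarrow> 'b \<Rightarrow> bool) \<Rightarrow> bool" where
  "order_isomorphic A leA B leB \<longleftrightarrow>
     (\<exists>f. bij_betw f A B \<and> (\<forall>a\<in>A. \<forall>b\<in>A. leA a b \<longleftrightarrow> leB (f a) (f b)))"

definition realises :: "'a::euclidean_space set \<Rightarrow> 'b set set \<Rightarrow> bool" where
  "realises P K \<longleftrightarrow> order_isomorphic {F. F face_of P \<and> F \<noteq> {}} (\<subseteq>) K (\<supseteq>)"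


lemma tail_chain_image: "tail_chain k l i = (\<lambda>j. i ` {j..k + l}) ` {1..k}"
  by (auto simp: tail_chain_def)

lemma card_tail:
  assumes "admissible n k l i" "1 \<le> j"
  shows "card (i ` {j..k + l}) = k + l + 1 - j"
proof -
  have "inj_on i {j..k + l}"
    using assms inj_on_subset[of i "{1..k + l}" "{j..k + l}"] by (simp add: admissible_def)
  then show ?thesis by (simp add: card_image)
qed

lemma inj_on_tail:
  assumes "admissible n k l i"
  shows "inj_on (\<lambda>j. i ` {j..k + l}) {1..k}"
proof (rule inj_onI)
  fix a b
  assume ab: "a \<in> {1..k}" "b \<in> {1..k}" and eq: "i ` {a..k + l} = i ` {b..k + l}"
  have "k + l + 1 - a = k + l + 1 - b"
    using card_tail[OF assms, of a] card_tail[OF assms, of b] ab eq by simp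
  then show "a = b" using ab by auto
qed

lemma card_tail_chain: "admissible n k l i \<Longrightarrow> card (tail_chain k l i) = k"
  by (simp only: tail_chain_image card_image[OF inj_on_tail] card_atLeastAtMost)

lemma card_Union_tail_chain:
  assumes "admissible n k l i"
  shows "card (\<Union>(tail_chain k l i)) = k + l"
proof -
  have "1 \<in> {1..k}" using assms by (simp add: admissible_def)
  then have "i ` {1..k + l} \<subseteq> (\<Union>j\<in>{1..k}. i ` {j..k + l})"
    by (rule UN_upper)
  moreover have "(\<Union>j\<in>{1..k}. i ` {j..k + l}) \<subseteq> i ` {1..k + l}"
    by (rule UN_least, rule image_mono) simp
  ultimately have "(\<Union>j\<in>{1..k}. i ` {j..k + l}) = i ` {1..k + l}"
    by (rule equalityI[rotated])
  then have "\<Union>(tail_chain k l i) = i ` {1..k + l}"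
    by (simp only: tail_chain_image)
  then show ?thesis using card_tail[OF assms, of 1] by simp
qed

lemma sum_tail_chain:
  fixes i :: "nat \<Rightarrow> 'm::finite" and x :: "real ^ 'm"
  assumes adm: "admissible n k l i"
  shows "(\<Sum>j = 1..<k. real j * x $ i j) + real k * (\<Sum>j = k..k + l. x $ i j)
           = (\<Sum>S\<in>tail_chain k l i. \<Sum>v\<in>S. x $ v)"
proof -
  have k: "1 \<le> k" using adm by (simp add: admissible_def)
  have "(\<Sum>S\<in>tail_chain k l i. \<Sum>v\<in>S. x $ v) = (\<Sum>a = 1..k. \<Sum>v\<in>i ` {a..k + l}. x $ v)"
    unfolding tail_chain_image by (subst sum.reindex[OF inj_on_tail[OF adm]]) (simp only: o_def)
  also have "\<dots> = (\<Sum>a = 1..k. \<Sum>j = a..k + l. x $ i j)"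
  proof (rule sum.cong[OF refl])
    fix a assume "a \<in> {1..k}"
    then have "inj_on i {a..k + l}"
      using adm inj_on_subset[of i "{1..k + l}" "{a..k + l}"] by (simp add: admissible_def)
    then show "(\<Sum>v\<in>i ` {a..k + l}. x $ v) = (\<Sum>j = a..k + l. x $ i j)"
      by (simp add: sum.reindex)
  qed
  also have "\<dots> = (\<Sum>a = 1..k. \<Sum>j = 1..k + l. if a \<le> j then x $ i j else 0)"
  proof (rule sum.cong[OF refl])
    fix a assume "a \<in> {1..k}"
    then have "{a..k + l} = {j \<in> {1..k + l}. a \<le> j}" by auto
    then have "(\<Sum>j = a..k + l. x $ i j) = (\<Sum>j\<in>{j \<in> {1..k + l}. a \<le> j}. x $ i j)"
      by (rule arg_cong)
    also have "\<dots> = (\<Sum>j = 1..k + l. if a \<le> j then x $ i j else 0)"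
      by (rule sum.inter_filter) (rule finite_atLeastAtMost)
    finally show "(\<Sum>j = a..k + l. x $ i j) = (\<Sum>j = 1..k + l. if a \<le> j then x $ i j else 0)" .
  qed
  also have "\<dots> = (\<Sum>j = 1..k + l. \<Sum>a = 1..k. if a \<le> j then x $ i j else 0)"
    by (rule sum.swap)
  also have "\<dots> = (\<Sum>j = 1..k + l. real (min j k) * x $ i j)"
  proof (rule sum.cong[OF refl])
    fix j
    have "(\<Sum>a = 1..k. if a \<le> j then x $ i j else 0) = (\<Sum>a\<in>{a \<in> {1..k}. a \<le> j}. x $ i j)"
      by (rule sum.inter_filter[symmetric]) (rule finite_atLeastAtMost)
    also have "{a \<in> {1..k}. a \<le> j} = {1..min j k}" by auto
    finally show "(\<Sum>a = 1..k. if a \<le> j then x $ i j else 0) = real (min j k) * x $ i j"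
      by simp
  qed
  also have "{1..k + l} = {1..<k} \<union> {k..k + l}" using k by auto
  also have "(\<Sum>j\<in>{1..<k} \<union> {k..k + l}. real (min j k) * x $ i j)
      = (\<Sum>j = 1..<k. real (min j k) * x $ i j) + (\<Sum>j = k..k + l. real (min j k) * x $ i j)"
    by (rule sum.union_disjoint) auto
  also have "\<dots> = (\<Sum>j = 1..<k. real j * x $ i j) + real k * (\<Sum>j = k..k + l. x $ i j)"
    by (simp add: sum_distrib_left)
  finally show ?thesis by simp
qed

lemma halfspace_tail_chain:
  assumes "admissible n k l i"
  shows "halfspace n (tail_chain k l i) = {x. chain_ineq n k l i x}"
proof -
  have "chain_ineq n k' l' i' x"
    if "admissible n k' l' i'" "tail_chain k l i = tail_chain k' l' i'" "chain_ineq n k l i x"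
    for k' l' i' x
  proof -
    have "k' = k" using card_tail_chain that assms by metis
    moreover have "k' + l' = k + l" using card_Union_tail_chain that assms by metis
    ultimately show ?thesis
      using that sum_tail_chain[OF assms, of x] sum_tail_chain[OF that(1), of x]
      by (simp add: chain_ineq_def)
  qed
  then show ?thesis using assms by (auto simp: halfspace_def)
qed

end

theory Submission
  imports Defs
begin

text \<open>
  The proof separates convex geometry from combinatorics. For any polyhedron given by finitely many
  inequalities, the nonempty faces correspond, with inclusion reversed, to the sets that consist of all
  inequalities tight at some point (\<open>realises_tight\<close>). If these tight sets form a simplicial complex,
  then adding one inequality lowers the dimension of a face by exactly one (\<open>aff_dim_face\<close>), and so the
  polyhedron is simple as soon as it is bounded (\<open>simple_polytope_P\<close>). Since \<open>C n\<close> is closed under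
  subsets, everything follows once the tight sets of the points of \<open>PA n\<close> are shown to be exactly the
  1-nested sets.

  Measure a set \<open>S\<close> by its excess, the rescaled difference between \<open>\<Sum>v\<in>S. x $ v\<close> and \<open>3 ^ card S\<close>. A chain
  of \<open>k\<close> sets then demands that its excesses add up to at least \<open>3 ^ k\<close>. In a tight chain each single
  excess is small, whereas two incomparable sets with small excess would force the mass of their union below
  the power of three that it needs. So all tight chains lie in one flag of subsets with sizes \<open>1, \<dots>, n\<close>, where
  members of \<open>B1 n\<close> are intervals of sizes. Two tight intervals cannot overlap or be adjacent without
  inclusion, because their union demands more than both together. In a flag this is precisely 1-nestedness
  (\<open>nested_iff_separated\<close>), so tight sets are nested (\<open>tight_chains_nested\<close>).

  Conversely, given a 1-nested set, fix a flag that contains it. The excesses along a flag can be prescribed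
  freely, and a recursive cutting of the interval of sizes yields excesses whose equality cases are the given
  intervals and no others (\<open>nested_intervals_weights\<close>). These excesses are so small that every set outside
  the flag has a large excess, which makes the inequality of any chain leaving the flag strict
  (\<open>nested_tight_chains\<close>).
\<close>

section \<open>Faces of a polyhedron and tight inequalities\<close>

locale inequality_system =
  fixes B :: "'i set" and a :: "'i \<Rightarrow> 'a::euclidean_space" and b :: "'i \<Rightarrow> real" and H :: "'a set"
  assumes finite_B: "finite B" and affine_H: "affine H"
begin

definition P :: "'a set" where
  "P = {x \<in> H. \<forall>i\<in>B. b i \<le> a i \<bullet> x}"

definition tight :: "'a \<Rightarrow> 'i set" where
  "tight x = {i \<in> B. a i \<bullet> x = b i}"

definition face :: "'i set \<Rightarrow> 'a set" where
  "face N = {x \<in> P. N \<subseteq> tight x}"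

lemma P_Int: "P = H \<inter> \<Inter>((\<lambda>i. {x. b i \<le> a i \<bullet> x}) ` B)"
  by (auto simp: P_def)

lemma polyhedron_P: "polyhedron P"
  unfolding P_Int using finite_B affine_H
  by (auto simp: affine_imp_polyhedron intro!: polyhedron_Int polyhedron_Inter polyhedron_halfspace_ge)

lemma convex_P: "convex P"
  by (simp add: polyhedron_P polyhedron_imp_convex)

lemma tight_subset: "tight x \<subseteq> B"
  by (auto simp: tight_def)

text \<open>
  A convex combination of nonnegative slacks, with positive coefficients, vanishes only when both
  slacks do. Hence passing to a point between \<open>x\<close> and \<open>y\<close> intersects the tight sets.
\<close>
lemma tight_open_segment:
  assumes "x \<in> P" "y \<in> P" "z \<in> open_segment x y"
  shows "tight z = tight x \<inter> tight y"
proof -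
  obtain u where u: "0 < u" "u < 1" and z: "z = (1 - u) *\<^sub>R x + u *\<^sub>R y"
    using assms(3) by (auto simp: in_segment)
  have "a i \<bullet> z = b i \<longleftrightarrow> a i \<bullet> x = b i \<and> a i \<bullet> y = b i" if "i \<in> B" for i
  proof -
    have "b i \<le> a i \<bullet> x" "b i \<le> a i \<bullet> y"
      using assms that by (auto simp: P_def)
    then have nonneg: "0 \<le> (1 - u) * (a i \<bullet> x - b i)" "0 \<le> u * (a i \<bullet> y - b i)"
      using u by auto
    have "a i \<bullet> z - b i = (1 - u) * (a i \<bullet> x - b i) + u * (a i \<bullet> y - b i)"
      by (simp add: z inner_add_right algebra_simps)
    then have "a i \<bullet> z = b i \<longleftrightarrow> (1 - u) * (a i \<bullet> x - b i) = 0 \<and> u * (a i \<bullet> y - b i) = 0"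
      using nonneg by linarith
    then show ?thesis using u by auto
  qed
  then show ?thesis by (auto simp: tight_def)
qed

lemma face_face_of: "face N face_of P"
  unfolding face_of_def
proof (intro conjI ballI impI)
  show "convex (face N)"
  proof (rule convexI)
    fix x y u v
    assume xy: "x \<in> face N" "y \<in> face N" and uv: "0 \<le> u" "0 \<le> v" "u + v = (1::real)"
    have "u *\<^sub>R x + v *\<^sub>R y \<in> P"
      using xy uv convex_P by (auto simp: face_def convex_def)
    moreover have "a i \<bullet> (u *\<^sub>R x + v *\<^sub>R y) = b i" if "i \<in> N" for i
    proof -
      have "a i \<bullet> x = b i" "a i \<bullet> y = b i" using xy that by (auto simp: face_def tight_def)
      then show ?thesis using uv by (simp add: inner_add_right flip: distrib_right)
    qed
    ultimately show "u *\<^sub>R x + v *\<^sub>R y \<in> face N"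
      using xy by (auto simp: face_def tight_def)
  qed
qed (auto simp: face_def tight_open_segment)

text \<open>
  Moving from \<open>x\<close> away from \<open>y\<close>, the constraints tight at \<open>x\<close> stay tight because they are tight at
  \<open>y\<close> too, and the finitely many others are strict at \<open>x\<close> and survive a small move. So \<open>x\<close> lies strictly
  between \<open>y\<close> and another point of the polyhedron, which forces \<open>y\<close> into every face through \<open>x\<close>.
\<close>
lemma prolong_segment:
  assumes x: "x \<in> P" and y: "y \<in> P" and "tight x \<subseteq> tight y" and "x \<noteq> y"
  shows "\<exists>z\<in>P. x \<in> open_segment y z"
proof -
  define z where "z t = x + t *\<^sub>R (x - y)" for t :: real
  have "\<forall>\<^sub>F t in at_right 0. b i \<le> a i \<bullet> z t" if i: "i \<in> B" for i
  proof (cases "i \<in> tight x")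
    case True
    then have "a i \<bullet> x = b i" "a i \<bullet> y = b i" using assms(3) by (auto simp: tight_def)
    then show ?thesis by (simp add: z_def inner_add_right inner_diff_right)
  next
    case False
    have "((\<lambda>t. a i \<bullet> z t) \<longlongrightarrow> a i \<bullet> z 0) (at_right 0)"
      unfolding z_def by (intro tendsto_intros)
    moreover have "b i < a i \<bullet> z 0"
      using False x i by (force simp: tight_def P_def z_def)
    ultimately have "\<forall>\<^sub>F t in at_right 0. b i < a i \<bullet> z t"
      by (rule order_tendstoD)
    then show ?thesis by (rule eventually_mono) simp
  qed
  then have "\<forall>\<^sub>F t in at_right 0. \<forall>i\<in>B. b i \<le> a i \<bullet> z t"
    by (simp add: eventually_ball_finite finite_B)
  moreover have "\<forall>\<^sub>F t in at_right 0. (0::real) < t"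
    by (rule eventually_at_right_less)
  ultimately have "\<forall>\<^sub>F t in at_right 0. 0 < t \<and> (\<forall>i\<in>B. b i \<le> a i \<bullet> z t)"
    by (rule eventually_elim2) simp
  then obtain t where t: "0 < t" "\<forall>i\<in>B. b i \<le> a i \<bullet> z t"
    by (metis (no_types, lifting) eventually_happens trivial_limit_at_right_real)
  have "z t = (1 + t) *\<^sub>R x + (- t) *\<^sub>R y" by (simp add: z_def algebra_simps)
  moreover have "(1 + t) *\<^sub>R x + (- t) *\<^sub>R y \<in> H"
    using x y by (intro mem_affine[OF affine_H]) (auto simp: P_def)
  ultimately have "z t \<in> P" using t by (simp add: P_def)
  moreover have "x = (1 - 1 / (1 + t)) *\<^sub>R y + (1 / (1 + t)) *\<^sub>R z t"
  proof -
    define s where "s = 1 / (1 + t)"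
    have s: "s * t = 1 - s" using t by (simp add: s_def field_simps)
    have "(1 - s) *\<^sub>R y + s *\<^sub>R z t = (1 - s) *\<^sub>R y + s *\<^sub>R x + (s * t) *\<^sub>R (x - y)"
      by (simp add: z_def scaleR_add_right)
    also have "\<dots> = x" unfolding s by (simp add: algebra_simps)
    finally show ?thesis by (simp add: s_def)
  qed
  then have "x \<in> open_segment y (z t)"
    using t assms(4) by (auto simp: in_segment z_def intro!: exI[of _ "1 / (1 + t)"])
  ultimately show ?thesis by blast
qed

text \<open>
  A point \<open>x\<close> of the face \<open>F\<close> with the fewest tight constraints has its tight set contained in that of
  every other point of \<open>F\<close>, since otherwise a midpoint would do better. Prolonging segments shows that
  \<open>F\<close> contains all points whose tight set includes that of \<open>x\<close>.
\<close>
lemma face_of_P_eq_face: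
  assumes F: "F face_of P" and "F \<noteq> {}"
  shows "\<exists>x\<in>F. F = face (tight x)"
proof -
  have "finite (tight y)" for y
    using finite_B tight_subset by (rule finite_subset[rotated])
  obtain x where x: "x \<in> F" and min: "\<And>y. y \<in> F \<Longrightarrow> card (tight x) \<le> card (tight y)"
    using ex_has_least_nat[of "\<lambda>x. x \<in> F" _ "\<lambda>x. card (tight x)"] assms(2) by blast
  have FP: "F \<subseteq> P" and conv: "convex F" using F by (auto simp: face_of_def)
  have "tight x \<subseteq> tight y" if y: "y \<in> F" for y
  proof (cases "x = y")
    case False
    have "midpoint x y \<in> open_segment x y" using False by simp
    moreover have "open_segment x y \<subseteq> F"
      using conv x y convex_contains_open_segment by blast
    ultimately have m: "midpoint x y \<in> F" "tight (midpoint x y) = tight x \<inter> tight y"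
      using tight_open_segment[of x y "midpoint x y"] FP x y by blast+
    then have "card (tight x) \<le> card (tight x \<inter> tight y)" using min by metis
    then have "tight x \<inter> tight y = tight x"
      using \<open>finite (tight x)\<close> by (intro card_subset_eq) (auto intro: antisym card_mono)
    then show ?thesis by blast
  qed simp
  moreover have "y \<in> F" if y: "y \<in> P" "tight x \<subseteq> tight y" for y
  proof (cases "x = y")
    case False
    then obtain z where "z \<in> P" "x \<in> open_segment y z"
      using prolong_segment y x FP by blast
    then show ?thesis using F x y unfolding face_of_def by blast
  qed (use x in simp)
  ultimately have "F = face (tight x)" using FP by (auto simp: face_def)
  then show ?thesis using x by blast
qed

lemma face_subset_face_iff:
  assumes "N \<in> tight ` P"
  shows "face N \<subseteq> face M \<longleftrightarrow> M \<subseteq> N"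
  using assms by (auto simp: face_def)

lemma inj_on_face: "inj_on face (tight ` P)"
proof (rule inj_onI)
  fix M N assume MN: "M \<in> tight ` P" "N \<in> tight ` P" "face M = face N"
  then have "face M \<subseteq> face N" "face N \<subseteq> face M" by simp_all
  then show "M = N" using MN(1,2) by (simp add: face_subset_face_iff subset_antisym)
qed

lemma nonempty_faces: "{F. F face_of P \<and> F \<noteq> {}} = face ` tight ` P"
proof
  show "{F. F face_of P \<and> F \<noteq> {}} \<subseteq> face ` tight ` P"
  proof (clarify)
    fix F assume F: "F face_of P" "F \<noteq> {}"
    then obtain x where "x \<in> F" "F = face (tight x)" using face_of_P_eq_face by blast
    then show "F \<in> face ` tight ` P" using face_of_imp_subset[OF F(1)] by blast
  qed
  show "face ` tight ` P \<subseteq> {F. F face_of P \<and> F \<noteq> {}}"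
    using face_face_of by (auto simp: face_def)
qed

text \<open>
  The nonempty faces are in order-reversing bijection with the sets that occur as tight sets of points.
  Which sets occur is the only thing left to find out for a concrete system of inequalities.
\<close>
lemma realises_tight: "realises P (tight ` P)"
  unfolding realises_def order_isomorphic_def nonempty_faces
proof (intro exI conjI ballI)
  show "bij_betw (inv_into (tight ` P) face) (face ` tight ` P) (tight ` P)"
    by (rule bij_betw_inv_into) (simp add: bij_betw_def inj_on_face)
next
  fix F G assume "F \<in> face ` tight ` P" "G \<in> face ` tight ` P"
  then obtain M N where "M \<in> tight ` P" "F = face M" "N \<in> tight ` P" "G = face N"
    by blast
  then show "F \<subseteq> G \<longleftrightarrow> inv_into (tight ` P) face G \<subseteq> inv_into (tight ` P) face F"
    by (simp add: inv_into_f_f[OF inj_on_face] face_subset_face_iff)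
qed

lemma face_empty: "face {} = P"
  by (simp add: face_def)

text \<open>
  When the tight sets form a simplicial complex, adding one constraint to \<open>N\<close> lowers the dimension by
  exactly one: a facet of \<open>face N\<close> containing \<open>face (insert i N)\<close> corresponds to a tight set strictly
  above \<open>N\<close> and inside \<open>insert i N\<close>.
\<close>
lemma aff_dim_face:
  assumes down: "\<And>M N. N \<in> tight ` P \<Longrightarrow> M \<subseteq> N \<Longrightarrow> M \<in> tight ` P"
    and "N \<in> tight ` P"
  shows "aff_dim (face N) = aff_dim P - int (card N)"
proof -
  have "finite N" using assms(2) finite_B tight_subset by (auto intro: finite_subset)
  then show ?thesis using assms(2)
  proof (induction N)
    case empty
    show ?case by (simp add: face_empty)
  next
    case (insert i N)
    have N: "N \<in> tight ` P" using down[OF insert.prems] by blast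
    then have dim: "aff_dim (face N) = aff_dim P - int (card N)" by (rule insert.IH)
    have sub: "face (insert i N) \<subseteq> face N" by (auto simp: face_def)
    have "face N \<subseteq> P" by (auto simp: face_def)
    then have "face (insert i N) face_of face N"
      by (rule face_of_subset[OF face_face_of sub])
    moreover have "face (insert i N) \<noteq> {}" using insert.prems by (auto simp: face_def)
    moreover have "face (insert i N) \<noteq> face N"
      using inj_onD[OF inj_on_face _ insert.prems N] insert.hyps(2) by blast
    moreover have "polyhedron (face N)"
      using polyhedron_P face_face_of by (rule face_of_polyhedron_polyhedron)
    ultimately obtain G where G: "G facet_of face N" "face (insert i N) \<subseteq> G"
      using face_of_polyhedron_subset_facet by blast
    have GN: "G face_of face N" "G \<noteq> {}" using G(1) unfolding facet_of_def by blast+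
    have "G face_of P" by (rule face_of_trans[OF GN(1) face_face_of])
    moreover have "G \<subseteq> face N" by (rule face_of_imp_subset[OF GN(1)])
    ultimately have "G \<in> face ` tight ` P" and GsubN: "G \<subseteq> face N"
      using GN(2) by (simp_all flip: nonempty_faces)
    then obtain M where M: "M \<in> tight ` P" "G = face M" by (blast elim: imageE)
    have "N \<subseteq> M" "M \<subseteq> insert i N"
      using M G GsubN insert.prems by (simp_all add: face_subset_face_iff)
    moreover have "M \<noteq> N" using G M by (auto simp: facet_of_def)
    ultimately have "M = insert i N" by blast
    then show ?case using G M dim insert.hyps by (simp add: facet_of_def)
  qed
qed

text \<open>
  A vertex has dimension zero, so by the dimension formula its tight set has as many elements as the
  dimension of the polytope; each element \<open>i\<close> of it contributes the single facet \<open>face {i}\<close>.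
\<close>
lemma simple_polytope_P:
  assumes down: "\<And>M N. N \<in> tight ` P \<Longrightarrow> M \<subseteq> N \<Longrightarrow> M \<in> tight ` P"
    and "bounded P"
  shows "simple_polytope P"
  unfolding simple_polytope_def
proof (intro conjI allI impI)
  show "polytope P" using polyhedron_P assms(2) by (simp add: polytope_eq_bounded_polyhedron)
next
  fix v assume v: "v extreme_point_of P"
  then have "{v} face_of P" by (simp add: face_of_singleton)
  then have eq: "{v} = face (tight v)" using face_of_P_eq_face by blast
  have vP: "v \<in> P" using v by (simp add: extreme_point_of_def)
  have card: "int (card (tight v)) = aff_dim P"
    using aff_dim_face[where N = "tight v", OF down] vP by (simp flip: eq)
  have single: "{i} \<in> tight ` P" if "i \<in> tight v" for i
    using down[where N = "tight v" and M = "{i}"] that vP by simp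
  have "{F. F facet_of P \<and> v \<in> F} = (\<lambda>i. face {i}) ` tight v"
  proof (intro equalityI subsetI)
    fix F assume F: "F \<in> {F. F facet_of P \<and> v \<in> F}"
    then have "F \<in> face ` tight ` P" by (simp add: facet_of_def flip: nonempty_faces)
    then obtain M where M: "M \<in> tight ` P" "F = face M" by (blast elim: imageE)
    then have "card M = 1" using aff_dim_face[where N = M, OF down M(1)] F by (auto simp: facet_of_def)
    then obtain i where "M = {i}" by (rule card_1_singletonE)
    then show "F \<in> (\<lambda>i. face {i}) ` tight v" using M F by (auto simp: face_def)
  next
    fix F assume "F \<in> (\<lambda>i. face {i}) ` tight v"
    then obtain i where i: "i \<in> tight v" "F = face {i}" by blast
    then show "F \<in> {F. F facet_of P \<and> v \<in> F}"
      using aff_dim_face[where N = "{i}", OF down single[OF i(1)]] vP face_face_of[of "{i}"]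
      by (auto simp: facet_of_def face_def)
  qed
  moreover have "inj_on (\<lambda>i. face {i}) (tight v)"
    by (rule inj_onI) (use inj_onD[OF inj_on_face _ single single] in blast)
  ultimately show "int (card {F. F facet_of P \<and> v \<in> F}) = aff_dim P"
    using card by (simp add: card_image)
qed

text \<open>
  A point with no tight constraint has a neighbourhood in \<open>H\<close> inside the polyhedron.
\<close>
lemma aff_dim_P:
  assumes "{} \<in> tight ` P"
  shows "aff_dim P = aff_dim H"
proof -
  define U where "U = (\<Inter>i\<in>B. {x. b i < a i \<bullet> x})"
  obtain x where "x \<in> P" "tight x = {}" using assms by auto
  then have "x \<in> H \<inter> U" by (force simp: U_def P_def tight_def)
  moreover have "open U"
    unfolding U_def using finite_B by (auto intro: open_halfspace_gt)
  ultimately have "affine hull (H \<inter> U) = affine hull H"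
    using affine_hull_affine_Int_open[OF affine_H] by (metis empty_iff)
  then have "aff_dim (H \<inter> U) = aff_dim H" by (metis aff_dim_affine_hull)
  moreover have "H \<inter> U \<subseteq> P" "P \<subseteq> H" by (auto simp: P_def U_def less_imp_le)
  ultimately show ?thesis using aff_dim_subset by (metis antisym)
qed

end

section \<open>The inequalities in terms of excesses\<close>

definition mass :: "real ^ 'm::finite \<Rightarrow> 'm set \<Rightarrow> real" where
  "mass x S = (\<Sum>v\<in>S. x $ v)"

definition gap :: "nat \<Rightarrow> real" where
  "gap n = 3 ^ n - real n - 1"

text \<open>
  The affine change of scale that turns the right hand sides \<open>kappa n k l\<close> into pure powers of three:
  the constraint of a chain \<open>\<beta>\<close> reads \<open>3 ^ card \<beta> \<le> (\<Sum>S\<in>\<beta>. excess n x S)\<close>. The first summand of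
  \<open>kappa\<close> is absorbed by the terms \<open>3 ^ card S\<close>, the second by the factor \<open>gap n\<close> and the constant 3.
\<close>
definition excess :: "nat \<Rightarrow> real ^ 'm::finite \<Rightarrow> 'm set \<Rightarrow> real" where
  "excess n x S = gap n * (mass x S - 3 ^ card S) + 3"

lemma power3_growth:
  assumes "k \<le> n"
  shows "3 ^ k + 2 * real (n - k) \<le> (3::real) ^ n"
  using assms
proof (induction rule: dec_induct)
  case (step m)
  have "(1::real) \<le> 3 ^ m" by simp
  moreover have "real (Suc m - k) = real (m - k) + 1" using step by (simp add: Suc_diff_le)
  ultimately show ?case using step.IH unfolding power_Suc by linarith
qed simp

lemma gap_pos:
  assumes "1 \<le> n"
  shows "0 < gap n"
  using power3_growth[OF assms] assms by (simp add: gap_def of_nat_diff)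

text \<open>
  This is the reason for the denominator of \<open>kappa\<close>: the perturbation \<open>(3 ^ k - 3 * k) / gap n\<close> never
  exceeds 1.
\<close>
lemma power3_le_gap:
  assumes "1 \<le> k" "k \<le> n"
  shows "3 ^ k - 3 * real k \<le> gap n"
proof -
  have "3 ^ k + 2 * (real n - real k) \<le> 3 ^ n"
    using power3_growth[OF assms(2)] assms by (simp add: of_nat_diff)
  moreover have "1 \<le> real k" "real k \<le> real n" using assms by simp_all
  moreover have "x - 3 * k' \<le> y - n' - 1"
    if "x + 2 * (n' - k') \<le> y" "1 \<le> k'" "k' \<le> n'" for x y n' k' :: real
    using that by (simp add: algebra_simps)
  ultimately show ?thesis unfolding gap_def by blast
qed

text \<open>
  The only convexity used: a power of three exceeds the sum of two lower ones, with a margin of at least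
  another such power.
\<close>
lemma power3_superadditive:
  assumes "a < c" "b < c"
  shows "(3::real) ^ a + 3 ^ b + 3 ^ max a b \<le> 3 ^ c"
proof -
  have "(3::real) ^ Suc (max a b) \<le> 3 ^ c" using assms by (intro power_increasing) auto
  moreover have "(3::real) ^ a \<le> 3 ^ max a b" "(3::real) ^ b \<le> 3 ^ max a b"
    by (intro power_increasing; simp)+
  ultimately show ?thesis unfolding power_Suc by linarith
qed

lemma power3_superadditive_strict:
  assumes "a < c" "b < c"
  shows "(3::real) ^ a + 3 ^ b < 3 ^ c"
proof -
  have "(0::real) < 3 ^ max a b" by simp
  then show ?thesis using power3_superadditive[OF assms] by linarith
qed

lemma excess_ge_3_iff:
  "1 \<le> n \<Longrightarrow> 3 \<le> excess n x S \<longleftrightarrow> 3 ^ card S \<le> mass x S"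
  using gap_pos[of n] by (simp add: excess_def zero_le_mult_iff)

lemma excess_le_iff:
  "1 \<le> n \<Longrightarrow> excess n x S \<le> gap n + 3 \<longleftrightarrow> mass x S \<le> 3 ^ card S + 1"
proof -
  assume "1 \<le> n"
  then have g: "0 < gap n" by (rule gap_pos)
  have "excess n x S \<le> gap n + 3 \<longleftrightarrow> gap n * (mass x S - 3 ^ card S) \<le> gap n * 1"
    by (simp add: excess_def)
  also have "\<dots> \<longleftrightarrow> mass x S - 3 ^ card S \<le> 1" using g by (simp only: mult_le_cancel_left_pos)
  finally show ?thesis by linarith
qed

definition chain_normal :: "'m set set \<Rightarrow> real ^ 'm::finite" where
  "chain_normal \<beta> = (\<Sum>S\<in>\<beta>. \<Sum>v\<in>S. axis v 1)"

definition chain_bound :: "nat \<Rightarrow> 'm set set \<Rightarrow> real" where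
  "chain_bound n \<beta> = (\<Sum>S\<in>\<beta>. 3 ^ card S) + (3 ^ card \<beta> - 3 * real (card \<beta>)) / gap n"

lemma chain_normal_inner: "chain_normal \<beta> \<bullet> x = (\<Sum>S\<in>\<beta>. mass x S)"
  by (simp add: chain_normal_def mass_def inner_sum_left inner_axis')

lemma sum_excess:
  assumes "1 \<le> n"
  shows "(\<Sum>S\<in>\<beta>. excess n x S) - 3 ^ card \<beta> = gap n * (chain_normal \<beta> \<bullet> x - chain_bound n \<beta>)"
proof -
  have "gap n * ((3 ^ card \<beta> - 3 * real (card \<beta>)) / gap n) = 3 ^ card \<beta> - 3 * real (card \<beta>)"
    using gap_pos[OF assms] by simp
  then show ?thesis
    by (simp only: chain_normal_inner chain_bound_def excess_def sum.distrib sum_subtractf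
      sum_constant right_diff_distrib distrib_left flip: sum_distrib_left)
qed

lemma chain_bound_le_iff:
  assumes "1 \<le> n"
  shows "chain_bound n \<beta> \<le> chain_normal \<beta> \<bullet> x \<longleftrightarrow> 3 ^ card \<beta> \<le> (\<Sum>S\<in>\<beta>. excess n x S)"
proof -
  have "3 ^ card \<beta> \<le> (\<Sum>S\<in>\<beta>. excess n x S) \<longleftrightarrow>
      0 \<le> gap n * (chain_normal \<beta> \<bullet> x - chain_bound n \<beta>)"
    by (simp flip: sum_excess[OF assms])
  then show ?thesis using gap_pos[OF assms] by (simp add: zero_le_mult_iff)
qed

lemma chain_bound_eq_iff:
  assumes "1 \<le> n"
  shows "chain_normal \<beta> \<bullet> x = chain_bound n \<beta> \<longleftrightarrow> (\<Sum>S\<in>\<beta>. excess n x S) = 3 ^ card \<beta>"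
proof -
  have "(\<Sum>S\<in>\<beta>. excess n x S) = 3 ^ card \<beta> \<longleftrightarrow>
      gap n * (chain_normal \<beta> \<bullet> x - chain_bound n \<beta>) = 0"
    by (simp flip: sum_excess[OF assms])
  then show ?thesis using gap_pos[OF assms] by simp
qed

text \<open>
  The sets of a chain \<open>tail_chain k l i\<close> have the sizes \<open>l + 1, \<dots>, l + k\<close>, so the first summand of
  \<open>kappa\<close> is a geometric sum over the chain.
\<close>
lemma kappa_eq_chain_bound:
  assumes "admissible n k l i"
  shows "kappa n k l = chain_bound n (tail_chain k l i)"
proof -
  have "(\<Sum>S\<in>tail_chain k l i. (3::real) ^ card S) = (\<Sum>j\<in>{1..k}. 3 ^ card (i ` {j..k + l}))"
    unfolding tail_chain_image by (subst sum.reindex[OF inj_on_tail[OF assms]]) (simp only: o_def)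
  also have "\<dots> = (\<Sum>j\<in>{1..k}. 3 ^ (k + l + 1 - j))"
    by (intro sum.cong) (simp_all add: card_tail[OF assms])
  also have "\<dots> = (3 ^ (k + l + 1) - 3 ^ (l + 1)) / 2"
  proof (induction k)
    case (Suc k)
    have "(\<Sum>j\<in>{1..Suc k}. (3::real) ^ (Suc k + l + 1 - j))
        = 3 ^ (Suc k + l) + (\<Sum>j\<in>{1..k}. 3 ^ (k + l + 1 - j))"
      by (subst sum.atLeast_Suc_atMost)
        (simp_all add: sum.atLeast_Suc_atMost_Suc_shift del: sum.cl_ivl_Suc)
    then show ?case unfolding Suc.IH by (simp add: field_simps)
  qed simp
  finally show ?thesis
    by (simp add: kappa_def chain_bound_def card_tail_chain[OF assms] gap_def)
qed

lemma chain_ineq_iff: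
  assumes "1 \<le> n" "admissible n k l i"
  shows "chain_ineq n k l i x \<longleftrightarrow>
    chain_bound n (tail_chain k l i) \<le> chain_normal (tail_chain k l i) \<bullet> x"
  unfolding chain_ineq_def sum_tail_chain[OF assms(2)] kappa_eq_chain_bound[OF assms(2)]
    chain_normal_inner mass_def by simp

lemma PA_eq:
  assumes "1 \<le> n"
  shows "PA n = {x :: real ^ 'm::finite. mass x UNIV = 3 ^ (n + 1) \<and>
    (\<forall>\<beta>\<in>B1 n. chain_bound n \<beta> \<le> chain_normal \<beta> \<bullet> x)}"
proof -
  have "x \<in> halfspace n \<beta> \<longleftrightarrow> chain_bound n \<beta> \<le> chain_normal \<beta> \<bullet> x"
    if \<beta>: "\<beta> \<in> B1 n" for x :: "real ^ 'm" and \<beta>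
  proof -
    obtain k l i where "admissible n k l i" "\<beta> = tail_chain k l i"
      using \<beta> by (auto simp: B1_def)
    then show ?thesis by (simp add: halfspace_tail_chain chain_ineq_iff[OF assms])
  qed
  then show ?thesis by (auto simp: PA_def mass_def)
qed

section \<open>Chains and flags of subsets\<close>

text \<open>
  The union of two incomparable sets is never empty, so a 0-nested set has no antichains at all.
\<close>
lemma C1_iff:
  "N \<in> C1 \<longleftrightarrow> (\<forall>S\<in>N. S \<noteq> {} \<and> S \<noteq> UNIV) \<and> (\<forall>S\<in>N. \<forall>T\<in>N. S \<subseteq> T \<or> T \<subseteq> S)"
proof -
  have empty: "C0 - B0 = {{}}" by (auto simp: C0_def B0_def)
  have B0: "N \<subseteq> B0 \<longleftrightarrow> (\<forall>S\<in>N. S \<noteq> {} \<and> S \<noteq> UNIV)" by (auto simp: C0_def B0_def)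
  have "(\<forall>A. antichain_in N A \<longrightarrow> \<Union>A = {}) \<longleftrightarrow> (\<forall>S\<in>N. \<forall>T\<in>N. S \<subseteq> T \<or> T \<subseteq> S)"
    if N: "\<forall>S\<in>N. S \<noteq> {} \<and> S \<noteq> UNIV"
  proof (intro iffI ballI allI impI)
    fix S T assume *: "\<forall>A. antichain_in N A \<longrightarrow> \<Union>A = {}" and ST: "S \<in> N" "T \<in> N"
    show "S \<subseteq> T \<or> T \<subseteq> S"
    proof (rule ccontr)
      assume inc: "\<not> (S \<subseteq> T \<or> T \<subseteq> S)"
      then have "card {S, T} = 2" by (auto simp: card_2_iff)
      then have "antichain_in N {S, T}" using ST inc by (auto simp: antichain_in_def)
      then have "\<Union>{S, T} = {}" using * by blast
      then show False using N ST by auto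
    qed
  next
    fix A assume *: "\<forall>S\<in>N. \<forall>T\<in>N. S \<subseteq> T \<or> T \<subseteq> S" and A: "antichain_in N A"
    have "S = T" if "S \<in> A" "T \<in> A" for S T
    proof (rule ccontr)
      assume "S \<noteq> T"
      then have "\<not> S \<subseteq> T" "\<not> T \<subseteq> S" using A that by (auto simp: antichain_in_def)
      moreover have "S \<in> N" "T \<in> N" using A that by (auto simp: antichain_in_def)
      ultimately show False using *[rule_format, of S T] by simp
    qed
    then have "card A \<le> Suc 0" using A by (subst card_le_Suc0_iff_eq) (auto simp: antichain_in_def)
    then show "\<Union>A = {}" using A by (simp add: antichain_in_def)
  qed
  then show ?thesis unfolding C1_def nested_def empty mem_Collect_eq B0 by auto
qed

lemma B1_subset_C1:
  assumes "CARD('m::finite) = n + 1"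
  shows "B1 n \<subseteq> (C1 :: 'm set set set)"
proof
  fix \<beta> :: "'m set set" assume "\<beta> \<in> B1 n"
  then obtain k l i where adm: "admissible n k l i" and \<beta>: "\<beta> = tail_chain k l i"
    by (auto simp: B1_def)
  have proper: "S \<noteq> {} \<and> S \<noteq> UNIV" if "S \<in> \<beta>" for S
  proof -
    obtain j where "1 \<le> j" "j \<le> k" "S = i ` {j..k + l}"
      using \<open>S \<in> \<beta>\<close> by (auto simp: \<beta> tail_chain_def)
    then have "0 < card S" "card S < CARD('m)"
      using card_tail[OF adm, of j] adm assms by (auto simp: admissible_def)
    then show ?thesis by auto
  qed
  have "i ` {j..k + l} \<subseteq> i ` {j'..k + l} \<or> i ` {j'..k + l} \<subseteq> i ` {j..k + l}" for j j'
    using linorder_linear[of j j'] by (auto intro: image_mono)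
  then have "\<forall>S\<in>\<beta>. \<forall>T\<in>\<beta>. S \<subseteq> T \<or> T \<subseteq> S" unfolding \<beta> tail_chain_image by blast
  then show "\<beta> \<in> C1" using proper by (simp add: C1_iff)
qed

lemma card_B1:
  assumes "\<beta> \<in> B1 n"
  shows "1 \<le> card \<beta>" "card \<beta> \<le> n"
  using assms by (auto simp: B1_def card_tail_chain admissible_def)

text \<open>
  Remove from \<open>V\<close> an element outside all the members of the chain other than \<open>V\<close> itself (the union of
  these members is one of them, hence proper); it can be listed last.
\<close>
lemma subset_chain_enumeration:
  assumes "finite V" "\<And>S. S \<in> \<C> \<Longrightarrow> S \<subseteq> V" "\<And>S T. S \<in> \<C> \<Longrightarrow> T \<in> \<C> \<Longrightarrow> S \<subseteq> T \<or> T \<subseteq> S"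
  shows "\<exists>xs. distinct xs \<and> set xs = V \<and> (\<forall>S\<in>\<C>. \<exists>s. S = set (take s xs))"
  using assms
proof (induction "card V" arbitrary: V \<C>)
  case 0
  then have "V = {}" by simp
  then show ?case using 0 by (auto intro!: exI[of _ "[]"])
next
  case (Suc m)
  define U where "U = \<Union>(\<C> - {V})"
  have "finite (\<C> - {V})"
    using Suc.prems by (auto intro: finite_subset[of _ "Pow V"])
  have "U \<subset> V"
  proof (cases "\<C> - {V} = {}")
    case True
    then have "U = {}" unfolding U_def by (simp only: Union_empty)
    then show ?thesis using Suc.hyps(2) by auto
  next
    case False
    have "U \<in> \<C> - {V}"
      unfolding U_def using \<open>finite (\<C> - {V})\<close> False
      by (rule Union_in_chain) (use Suc.prems in \<open>auto simp: subset_chain_def\<close>)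
    then show ?thesis using Suc.prems(2) by auto
  qed
  then obtain v where v: "v \<in> V" "v \<notin> U" by blast
  have "m = card (V - {v})" using Suc.hyps(2) v by (simp add: card_Diff_singleton)
  moreover have "S \<subseteq> V - {v}" if "S \<in> \<C> - {V}" for S
    using that v Suc.prems(2) by (auto simp: U_def)
  ultimately obtain xs where xs: "distinct xs" "set xs = V - {v}"
    "\<forall>S\<in>\<C> - {V}. \<exists>s. S = set (take s xs)"
    using Suc.hyps(1)[of "V - {v}" "\<C> - {V}"] Suc.prems by auto
  have "\<exists>s. S = set (take s (xs @ [v]))" if S: "S \<in> \<C>" for S
  proof (cases "S = V")
    case True
    then show ?thesis using xs v by (intro exI[of _ "Suc (length xs)"]) auto
  next
    case False
    then obtain s where "S = set (take s xs)" using xs(3) S by blast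
    also have "\<dots> = set (take (min s (length xs)) (xs @ [v]))" by (simp add: min_def)
    finally show ?thesis by blast
  qed
  then show ?case using xs v by (intro exI[of _ "xs @ [v]"]) auto
qed

definition initial :: "(nat \<Rightarrow> 'm) \<Rightarrow> nat \<Rightarrow> 'm set" where
  "initial e s = e ` {..<s}"

definition segment :: "(nat \<Rightarrow> 'm) \<Rightarrow> nat \<Rightarrow> nat \<Rightarrow> 'm set set" where
  "segment e c d = initial e ` {c..<d}"

locale enumeration =
  fixes n :: nat and e :: "nat \<Rightarrow> 'm::finite"
  assumes bij: "bij_betw e {..<n + 1} UNIV"
begin

lemma card_initial: "s \<le> n + 1 \<Longrightarrow> card (initial e s) = s"
  using bij unfolding initial_def
  by (subst card_image) (auto simp: bij_betw_def intro: inj_on_subset)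

lemma initial_Suc_n: "initial e (n + 1) = UNIV"
  using bij by (simp add: initial_def bij_betw_def)

lemma inj_on_initial: "inj_on (initial e) {..n + 1}"
  by (rule inj_onI) (metis atMost_iff card_initial)

lemma initial_mono: "s \<le> t \<Longrightarrow> initial e s \<subseteq> initial e t"
  by (auto simp: initial_def)

lemma segment_subset_iff:
  "d \<le> n + 2 \<Longrightarrow> d' \<le> n + 2 \<Longrightarrow> segment e c d \<subseteq> segment e c' d' \<longleftrightarrow> {c..<d} \<subseteq> {c'..<d'}"
  unfolding segment_def by (rule inj_on_image_subset_iff[OF inj_on_initial]) auto

lemma initial_in_segment_iff:
  "s \<le> n + 1 \<Longrightarrow> d \<le> n + 2 \<Longrightarrow> initial e s \<in> segment e c d \<longleftrightarrow> c \<le> s \<and> s < d"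
  unfolding segment_def by (subst inj_on_image_mem_iff[OF inj_on_initial]) auto

lemma card_segment: "d \<le> n + 2 \<Longrightarrow> card (segment e c d) = d - c"
  unfolding segment_def
  by (subst card_image) (auto intro: inj_on_subset[OF inj_on_initial])

lemma sum_segment: "d \<le> n + 2 \<Longrightarrow> sum f (segment e c d) = (\<Sum>s = c..<d. f (initial e s))"
  unfolding segment_def
  by (subst sum.reindex) (auto intro: inj_on_subset[OF inj_on_initial])

lemma segment_Un:
  "c \<le> c' \<Longrightarrow> c' \<le> d \<Longrightarrow> d \<le> d' \<Longrightarrow> segment e c d \<union> segment e c' d' = segment e c d'"
  unfolding segment_def by (subst image_Un[symmetric], rule arg_cong[of _ _ "image _"]) auto

lemma segment_in_B1:
  assumes "1 \<le> c" "c < d" "d \<le> n + 1"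
  shows "segment e c d \<in> B1 n"
proof -
  \<comment> \<open>A tail chain starts with its largest set, so the enumeration is read backwards from \<open>e (d - 2)\<close>.\<close>
  define i where "i j = e (d - 1 - j)" for j
  have kl: "d - c + (c - 1) = d - 1" using assms by simp
  have inj: "inj_on i {1..d - 1}"
  proof (rule inj_onI)
    fix x y assume xy: "x \<in> {1..d - 1}" "y \<in> {1..d - 1}" "i x = i y"
    have "inj_on e {..<n + 1}" using bij by (simp add: bij_betw_def)
    then have "d - 1 - x = d - 1 - y"
      using xy assms by (auto simp: i_def dest!: inj_onD)
    then show "x = y" using xy by auto
  qed
  have "i ` {j..d - 1} = initial e (d - j)" if "1 \<le> j" "j \<le> d - c" for j
  proof -
    have "(\<lambda>x. d - 1 - x) ` {j..d - 1} = {..<d - j}"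
    proof (intro equalityI subsetI)
      fix y assume "y \<in> {..<d - j}"
      then show "y \<in> (\<lambda>x. d - 1 - x) ` {j..d - 1}"
        by (intro image_eqI[of _ _ "d - 1 - y"]) auto
    qed (use that in auto)
    then show ?thesis unfolding i_def initial_def by (metis image_image)
  qed
  then have "tail_chain (d - c) (c - 1) i = (\<lambda>j. initial e (d - j)) ` {1..d - c}"
    unfolding tail_chain_image kl by (intro image_cong) auto
  also have "\<dots> = initial e ` (\<lambda>j. d - j) ` {1..d - c}" by (simp add: image_image)
  also have "(\<lambda>j. d - j) ` {1..d - c} = {c..<d}"
  proof (intro equalityI subsetI)
    fix y assume "y \<in> {c..<d}"
    then show "y \<in> (\<lambda>j. d - j) ` {1..d - c}" by (intro image_eqI[of _ _ "d - y"]) auto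
  qed auto
  finally have "segment e c d = tail_chain (d - c) (c - 1) i" by (simp add: segment_def)
  moreover have "admissible n (d - c) (c - 1) i"
    unfolding admissible_def kl using inj assms by auto
  ultimately show ?thesis by (auto simp: B1_def)
qed

text \<open>
  Inside a full flag a member of \<open>B1 n\<close> is determined by the sizes of its sets, and these are consecutive.
\<close>
lemma B1_segment:
  assumes "\<beta> \<in> B1 n" "\<beta> \<subseteq> segment e 1 (n + 1)"
  obtains c d where "1 \<le> c" "c < d" "d \<le> n + 1" "\<beta> = segment e c d"
proof -
  obtain k l i where adm: "admissible n k l i" and \<beta>: "\<beta> = tail_chain k l i"
    using assms(1) by (auto simp: B1_def)
  have "i ` {j..k + l} = initial e (k + l + 1 - j)" if j: "j \<in> {1..k}" for j
  proof -
    have "i ` {j..k + l} \<in> segment e 1 (n + 1)"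
      using j assms(2) unfolding \<beta> tail_chain_image by blast
    then obtain s where s: "i ` {j..k + l} = initial e s" "s \<in> {1..<n + 1}"
      unfolding segment_def by (rule imageE)
    then have "s = k + l + 1 - j"
      using card_initial[of s] card_tail[OF adm, of j] j by simp
    then show ?thesis using s by simp
  qed
  then have "\<beta> = (\<lambda>j. initial e (k + l + 1 - j)) ` {1..k}"
    unfolding \<beta> tail_chain_image by (intro image_cong) auto
  also have "\<dots> = initial e ` (\<lambda>j. k + l + 1 - j) ` {1..k}" by (simp add: image_image)
  also have "(\<lambda>j. k + l + 1 - j) ` {1..k} = {l + 1..<k + l + 1}"
  proof (intro equalityI subsetI)
    fix y assume "y \<in> {l + 1..<k + l + 1}"
    then show "y \<in> (\<lambda>j. k + l + 1 - j) ` {1..k}"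
      by (intro image_eqI[of _ _ "k + l + 1 - y"]) auto
  qed auto
  finally have "\<beta> = segment e (l + 1) (k + l + 1)" by (simp add: segment_def)
  then show ?thesis
    using adm by (intro that[of "l + 1" "k + l + 1"]) (simp_all add: admissible_def)
qed

end

lemma chain_in_segment:
  assumes "CARD('m::finite) = n + 1" and "\<C> \<in> (C1 :: 'm set set set)"
  obtains e where "enumeration n e" "\<C> \<subseteq> segment e 1 (n + 1)"
proof -
  obtain xs :: "'m list" where xs: "distinct xs" "set xs = UNIV" "\<forall>S\<in>\<C>. \<exists>s. S = set (take s xs)"
    using subset_chain_enumeration[of UNIV \<C>] assms(2) by (auto simp: C1_iff)
  have len: "length xs = n + 1" using xs assms(1) distinct_card by fastforce
  have "bij_betw (\<lambda>s. xs ! s) {..<n + 1} UNIV"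
    using bij_betw_nth[OF xs(1), of "{..<n + 1}" UNIV] xs(2) len by simp
  then have enum: "enumeration n (\<lambda>s. xs ! s)" by (rule enumeration.intro)
  moreover have "S \<in> segment (\<lambda>s. xs ! s) 1 (n + 1)" if S: "S \<in> \<C>" for S
  proof -
    obtain s where s: "S = set (take s xs)" using xs S by blast
    have proper: "S \<noteq> {}" "S \<noteq> UNIV" using S assms(2) by (auto simp: C1_iff)
    then have "1 \<le> s" "s < n + 1" using s xs(2) len by (auto intro: ccontr simp: not_less)
    moreover have "S = initial (\<lambda>s. xs ! s) s"
      unfolding s initial_def using \<open>s < n + 1\<close> len nth_image[of s xs] by (simp add: lessThan_atLeast0)
    ultimately show ?thesis by (auto simp: segment_def)
  qed
  ultimately show ?thesis using that by blast
qed

section \<open>Weights with prescribed equality cases on intervals\<close>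

text \<open>
  \<open>T c d\<close> says that the half-open interval \<open>[c, d)\<close> is selected. The case \<open>c' = d\<close> of adjacent intervals
  is excluded on purpose: the union of two adjacent intervals is an interval.
\<close>
definition separated :: "(nat \<Rightarrow> nat \<Rightarrow> bool) \<Rightarrow> bool" where
  "separated T \<longleftrightarrow> (\<forall>c d c' d'. c < c' \<longrightarrow> c' \<le> d \<longrightarrow> d < d' \<longrightarrow> \<not> (T c d \<and> T c' d'))"

text \<open>
  The total assigned to \<open>[a, b)\<close>: the minimum \<open>3 ^ (b - a)\<close> if the interval is selected. For the others
  any surplus would do that is positive, small enough for \<open>weight_gap\<close>, and keeps the entries at most
  \<open>gap n + 3\<close>.
\<close>
definition weight :: "(nat \<Rightarrow> nat \<Rightarrow> bool) \<Rightarrow> nat \<Rightarrow> nat \<Rightarrow> real" where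
  "weight T a b = (if b \<le> a then 0 else 3 ^ (b - a) + (if T a b then 0 else 1))"

definition fits :: "(nat \<Rightarrow> nat \<Rightarrow> bool) \<Rightarrow> (nat \<Rightarrow> real) \<Rightarrow> nat \<Rightarrow> nat \<Rightarrow> bool" where
  "fits T h a b \<longleftrightarrow> sum h {a..<b} = weight T a b \<and>
    (\<forall>c d. a \<le> c \<longrightarrow> c < d \<longrightarrow> d \<le> b \<longrightarrow>
      3 ^ (d - c) \<le> sum h {c..<d} \<and> (sum h {c..<d} = 3 ^ (d - c) \<longleftrightarrow> T c d))"

lemma weight_bound: "weight T a b \<le> (if b \<le> a then 0 else 3 ^ (b - a) + 1)"
  by (simp add: weight_def)

text \<open>
  If the interval is cut at \<open>p\<close>, the entry at \<open>p\<close> alone exceeds what any proper subinterval demands. The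
  reason is that the two remaining parts have together one point less than the whole.
\<close>
lemma weight_gap:
  assumes "a \<le> p" "p < b" "2 \<le> b - a"
  shows "3 ^ (b - a - 1) < weight T a b - weight T a p - weight T (Suc p) b"
proof -
  define m1 m2 where "m1 = p - a" and "m2 = b - Suc p"
  have m: "b - a = Suc (m1 + m2)" "m1 + m2 \<ge> 1" using assms by (auto simp: m1_def m2_def)
  define w where "w k = (if k = 0 then 0 else 3 ^ k + (1::real))" for k :: nat
  have "weight T a p \<le> w m1" "weight T (Suc p) b \<le> w m2"
    using weight_bound[of T a p] weight_bound[of T "Suc p" b]
    by (auto simp: w_def m1_def m2_def split: if_splits)
  moreover have "3 ^ Suc (m1 + m2) \<le> weight T a b"
    using assms m by (simp add: weight_def)
  moreover have "3 ^ (m1 + m2) + w m1 + w m2 < 3 ^ Suc (m1 + m2)"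
  proof -
    have pos: "(3::real) \<le> 3 ^ k" if "1 \<le> k" for k
      using power_increasing[OF that, of "3::real"] by simp
    show ?thesis
    proof (cases "m1 = 0 \<or> m2 = 0")
      case True
      then show ?thesis using m pos[of "m1 + m2"] by (auto simp: w_def)
    next
      case False
      then have "3 ^ Suc m1 \<le> (3::real) ^ (m1 + m2)" "3 ^ Suc m2 \<le> (3::real) ^ (m1 + m2)"
        by (intro power_increasing; simp)+
      moreover have "(3::real) \<le> 3 ^ m1" "(3::real) \<le> 3 ^ m2" using False pos by simp_all
      ultimately show ?thesis using False by (simp add: w_def)
    qed
  qed
  ultimately show ?thesis using m by simp
qed

text \<open>
  Take for \<open>p\<close> the end of the longest selected proper interval that starts at \<open>a\<close>, or \<open>a\<close> itself if
  there is none. Another selected proper interval containing \<open>p\<close> would either start at \<open>a\<close> and be longer,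
  or overlap the chosen one, or be adjacent to it.
\<close>
lemma nested_intervals_cut:
  assumes sep: "separated T"
    and "a < b"
  obtains p where "a \<le> p" "p < b"
    "\<And>c d. T c d \<Longrightarrow> a \<le> c \<Longrightarrow> c \<le> p \<Longrightarrow> p < d \<Longrightarrow> d \<le> b \<Longrightarrow> c = a \<and> d = b"
proof (cases "\<exists>d. T a d \<and> a < d \<and> d < b")
  case False
  show ?thesis by (rule that[of a]) (use False assms(2) in \<open>auto simp: le_less\<close>)
next
  case True
  define L where "L = {d. T a d \<and> a < d \<and> d < b}"
  have L: "finite L" "L \<noteq> {}"
    unfolding L_def using True by (auto intro: finite_subset[of _ "{..<b}"])
  define p where "p = Max L"
  have "p \<in> L" unfolding p_def using L by (rule Max_in)
  then have p: "T a p" "a < p" "p < b" by (auto simp: L_def)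
  show ?thesis
  proof (rule that[of p])
    fix c d assume T: "T c d" and cd: "a \<le> c" "c \<le> p" "p < d" "d \<le> b"
    have "c = a" proof (rule ccontr)
      assume "c \<noteq> a"
      then have "a < c" using cd by simp
      then show False using sep p(1) T cd(2,3) unfolding separated_def by blast
    qed
    moreover have "d \<notin> L"
      using Max_ge[OF L(1), of d] cd by (auto simp: p_def)
    ultimately show "c = a \<and> d = b" using T cd p by (auto simp: L_def)
  qed (use p in simp_all)
qed

text \<open>
  Every separated family is the exact set of equality cases of the constraints \<open>3 ^ (d - c) \<le> sum h {c..<d}\<close>.
  Cut the interval at a point \<open>p\<close> that no selected proper subinterval contains, treat both sides
  recursively, and give \<open>p\<close> whatever is missing to the prescribed total. Subintervals that avoid \<open>p\<close> are
  handled by recursion, those through \<open>p\<close> by \<open>weight_gap\<close>.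
\<close>
lemma nested_intervals_weights:
  assumes sep: "separated T"
  shows "\<exists>h. fits T h a b"
proof (induction "b - a" arbitrary: a b rule: less_induct)
  case less
  show ?case
  proof (cases "a < b")
    case False
    then show ?thesis by (auto simp: fits_def weight_def)
  next
    case True
    obtain p where p: "a \<le> p" "p < b"
      and cut: "\<And>c d. T c d \<Longrightarrow> a \<le> c \<Longrightarrow> c \<le> p \<Longrightarrow> p < d \<Longrightarrow> d \<le> b \<Longrightarrow> c = a \<and> d = b"
      by (rule nested_intervals_cut[OF sep True]) iprover
    obtain h1 h2 where "fits T h1 a p" "fits T h2 (Suc p) b"
      using less.hyps[of p a, OF diff_less_mono] less.hyps[of b "Suc p", OF diff_less_mono2] p
      by (metis le_imp_less_Suc le_less_trans)
    then have h1: "sum h1 {a..<p} = weight T a p"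
        "\<And>c d. a \<le> c \<Longrightarrow> c < d \<Longrightarrow> d \<le> p \<Longrightarrow>
          3 ^ (d - c) \<le> sum h1 {c..<d} \<and> (sum h1 {c..<d} = 3 ^ (d - c) \<longleftrightarrow> T c d)"
      and h2: "sum h2 {Suc p..<b} = weight T (Suc p) b"
        "\<And>c d. Suc p \<le> c \<Longrightarrow> c < d \<Longrightarrow> d \<le> b \<Longrightarrow>
          3 ^ (d - c) \<le> sum h2 {c..<d} \<and> (sum h2 {c..<d} = 3 ^ (d - c) \<longleftrightarrow> T c d)"
      by (simp_all add: fits_def)
    define q where "q = weight T a b - weight T a p - weight T (Suc p) b"
    define h where "h s = (if s < p then h1 s else if s = p then q else h2 s)" for s
    have left: "sum h {c..<d} = sum h1 {c..<d}" if "d \<le> p" for c d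
      using that by (intro sum.cong) (auto simp: h_def)
    have right: "sum h {c..<d} = sum h2 {c..<d}" if "Suc p \<le> c" for c d
      using that by (intro sum.cong) (auto simp: h_def)
    have "sum h {a..<b} = sum h {a..<p} + sum h {p..<b}"
      using p by (simp add: sum.atLeastLessThan_concat)
    also have "sum h {p..<b} = q + sum h {Suc p..<b}"
      using p by (simp add: sum.atLeast_Suc_lessThan h_def)
    finally have total: "sum h {a..<b} = weight T a b"
      by (simp add: left right h1 h2 q_def)
    have nonneg: "0 \<le> h s" if "a \<le> s" "s < b" "s \<noteq> p" for s
    proof (cases "s < p")
      case True
      then show ?thesis using h1(2)[of s "Suc s"] that by (simp add: h_def)
    next
      case False
      then show ?thesis using h2(2)[of s "Suc s"] that by (simp add: h_def)
    qed
    have "3 ^ (d - c) \<le> sum h {c..<d} \<and> (sum h {c..<d} = 3 ^ (d - c) \<longleftrightarrow> T c d)"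
      if cd: "a \<le> c" "c < d" "d \<le> b" for c d
    proof -
      consider "d \<le> p" | "Suc p \<le> c" | "c \<le> p" "p < d" "c = a" "d = b"
        | "c \<le> p" "p < d" "\<not> (c = a \<and> d = b)"
        by linarith
      then show ?thesis
      proof cases
        case 1
        then show ?thesis using h1(2) cd by (simp add: left)
      next
        case 2
        then show ?thesis using h2(2) cd by (simp add: right)
      next
        case 3
        then show ?thesis using total True by (simp add: weight_def)
      next
        case 4
        have "(3::real) ^ (d - c) \<le> 3 ^ (b - a - 1)"
          using cd 4 by (intro power_increasing) auto
        also have "\<dots> < q"
          unfolding q_def by (rule weight_gap) (use p cd 4 in auto)
        also have "q = h p" by (simp add: h_def)
        also have "h p \<le> sum h {c..<d}"
          using 4 cd nonneg by (intro member_le_sum) auto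
        finally show ?thesis using cut 4 cd by fastforce
      qed
    qed
    then have "fits T h a b" using total by (simp add: fits_def)
    then show ?thesis by blast
  qed
qed

section \<open>Nested sets inside a flag\<close>

context enumeration
begin

text \<open>
  Inside a full flag, 1-nestedness becomes a condition on pairs of intervals of sizes: the members are the
  tubes of a tubing of a path. A pair that overlaps or is adjacent without inclusion has an interval as its
  union, which is a forbidden member of \<open>B1 n\<close>. Conversely, if the union of an antichain is an interval
  \<open>[p, q)\<close>, then the member \<open>[p, b)\<close> that contains \<open>p\<close> together with a member that contains \<open>b\<close> is such
  a pair.
\<close>
lemma nested_iff_separated:
  fixes N :: "'m set set set"
  assumes N: "N \<subseteq> B1 n" and flag: "\<Union>N \<subseteq> segment e 1 (n + 1)"
  shows "nested C1 (B1 n) N \<longleftrightarrow>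
    separated (\<lambda>c d. 1 \<le> c \<and> d \<le> n + 1 \<and> segment e c d \<in> N)" (is "_ \<longleftrightarrow> separated ?T")
proof
  assume nested: "nested C1 (B1 n) N"
  show "separated ?T"
    unfolding separated_def
  proof (intro allI impI notI)
    fix c d c' d'
    assume cd: "c < c'" "c' \<le> d" "d < d'" and T: "?T c d \<and> ?T c' d'"
    have "\<not> segment e c d \<subseteq> segment e c' d'" "\<not> segment e c' d' \<subseteq> segment e c d"
      using cd T by (simp_all add: segment_subset_iff)
    moreover from this have "card {segment e c d, segment e c' d'} = 2"
      by (auto simp: card_2_iff)
    ultimately have "antichain_in N {segment e c d, segment e c' d'}"
      using T by (auto simp: antichain_in_def)
    then have "segment e c d \<union> segment e c' d' \<notin> B1 n"
      using nested by (auto simp: nested_def)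
    moreover have "segment e c d \<union> segment e c' d' = segment e c d'"
      using cd by (intro segment_Un) auto
    moreover have "segment e c d' \<in> B1 n"
      using cd T by (intro segment_in_B1) auto
    ultimately show False by simp
  qed
next
  assume sep: "separated ?T"
  have "\<Union>A \<in> C1 - B1 n" if A: "antichain_in N A" for A
  proof
    have AN: "A \<subseteq> N" and inc: "\<And>S T. S \<in> A \<Longrightarrow> T \<in> A \<Longrightarrow> S \<subseteq> T \<Longrightarrow> S = T"
      using A by (auto simp: antichain_in_def)
    have sub: "\<Union>A \<subseteq> segment e 1 (n + 1)" using AN flag by blast
    have "S \<noteq> {} \<and> S \<noteq> UNIV" if "S \<in> segment e 1 (n + 1)" for S
    proof -
      obtain s where s: "1 \<le> s" "s < n + 1" "S = initial e s"
        using \<open>S \<in> segment e 1 (n + 1)\<close> by (auto simp: segment_def)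
      then have "card S = s" "card (UNIV :: 'm set) = n + 1"
        using card_initial[of s] card_initial[of "n + 1"] initial_Suc_n by simp_all
      then show ?thesis using s by auto
    qed
    moreover have "S \<subseteq> T \<or> T \<subseteq> S" 
      if ST: "S \<in> segment e 1 (n + 1)" "T \<in> segment e 1 (n + 1)" for S T
    proof -
      obtain s where "S = initial e s" using ST(1) unfolding segment_def by (rule imageE)
      moreover obtain t where "T = initial e t" using ST(2) unfolding segment_def by (rule imageE)
      ultimately show ?thesis using linorder_linear[of s t] by (auto dest: initial_mono)
    qed
    ultimately show "\<Union>A \<in> C1" using sub unfolding C1_iff by blast
    show "\<Union>A \<notin> B1 n"
    proof
      assume "\<Union>A \<in> B1 n"
      then obtain p q where pq: "1 \<le> p" "p < q" "q \<le> n + 1" "\<Union>A = segment e p q"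
        using sub B1_segment by metis
      have interval: "\<exists>a b. p \<le> a \<and> a < b \<and> b \<le> q \<and> \<beta> = segment e a b" if \<beta>: "\<beta> \<in> A" for \<beta>
      proof -
        have "\<beta> \<in> B1 n" "\<beta> \<subseteq> segment e 1 (n + 1)" "\<beta> \<subseteq> segment e p q"
          using \<beta> AN N sub pq(4) by blast+
        then obtain a b where ab: "1 \<le> a" "a < b" "b \<le> n + 1" "\<beta> = segment e a b"
          using B1_segment by metis
        then have "{a..<b} \<subseteq> {p..<q}"
          using \<open>\<beta> \<subseteq> segment e p q\<close> pq by (simp add: segment_subset_iff)
        then show ?thesis using ab by auto
      qed
      have "initial e p \<in> \<Union>A" using pq by (simp add: initial_in_segment_iff)
      then obtain \<beta> where \<beta>: "\<beta> \<in> A" "initial e p \<in> \<beta>" by blast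
      then obtain a b where ab: "p \<le> a" "a < b" "b \<le> q" "\<beta> = segment e a b"
        using interval by blast
      then have "a = p" using \<beta>(2) pq by (simp add: initial_in_segment_iff)
      have "b < q"
      proof (rule ccontr)
        assume "\<not> b < q"
        then have "\<beta> = \<Union>A" using ab \<open>a = p\<close> pq by simp
        then have "A = {\<beta>}" using inc \<beta>(1) by blast
        then show False using A by (simp add: antichain_in_def)
      qed
      then have "initial e b \<in> \<Union>A" using pq ab by (simp add: initial_in_segment_iff)
      then obtain \<gamma> where \<gamma>: "\<gamma> \<in> A" "initial e b \<in> \<gamma>" by blast
      then obtain a' b' where ab': "p \<le> a'" "a' < b'" "b' \<le> q" "\<gamma> = segment e a' b'"
        using interval by blast
      then have b: "a' \<le> b" "b < b'" using \<gamma>(2) ab pq by (simp_all add: initial_in_segment_iff)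
      have "a' \<noteq> p"
      proof
        assume "a' = p"
        then have "\<beta> \<subseteq> \<gamma>" using ab ab' \<open>a = p\<close> b pq by (simp add: segment_subset_iff)
        then have "\<gamma> = \<beta>" using inc \<beta>(1) \<gamma>(1) by blast
        then show False using \<gamma>(2) ab pq by (simp add: initial_in_segment_iff)
      qed
      then have "a < a'" using ab' \<open>a = p\<close> by simp
      moreover have "?T a b" "?T a' b'" using ab ab' pq \<beta>(1) \<gamma>(1) AN by auto
      ultimately show False using sep b unfolding separated_def by blast
    qed
  qed
  then show "nested C1 (B1 n) N" using N by (simp add: nested_def)
qed

end

text \<open>
  Two members of a 1-nested set that are incomparable form an antichain, and its union lies in \<open>C1\<close>; so
  all sets occurring in the members are comparable, and the whole 1-nested set lives in one flag.
\<close>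
lemma Union_nested_in_C1:
  assumes "CARD('m::finite) = n + 1" and nested: "nested C1 (B1 n) (N :: 'm set set set)"
  shows "\<Union>N \<in> C1"
proof -
  have N: "N \<subseteq> C1" using nested B1_subset_C1[OF assms(1)] by (auto simp: nested_def)
  have "S \<subseteq> T \<or> T \<subseteq> S" if ST: "S \<in> \<beta>" "T \<in> \<gamma>" "\<beta> \<in> N" "\<gamma> \<in> N" for S T \<beta> \<gamma>
  proof -
    have "\<beta> \<union> \<gamma> \<in> C1"
    proof (cases "\<beta> \<subseteq> \<gamma> \<or> \<gamma> \<subseteq> \<beta>")
      case True
      then have "\<beta> \<union> \<gamma> = \<gamma> \<or> \<beta> \<union> \<gamma> = \<beta>" by blast
      then show ?thesis using N ST by auto
    next
      case False
      then have "card {\<beta>, \<gamma>} = 2" by (auto simp: card_2_iff)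
      then have "antichain_in N {\<beta>, \<gamma>}" using ST False by (auto simp: antichain_in_def)
      then show ?thesis using nested by (auto simp: nested_def)
    qed
    then show ?thesis using ST unfolding C1_iff by blast
  qed
  moreover have "S \<noteq> {} \<and> S \<noteq> UNIV" if "\<beta> \<in> N" "S \<in> \<beta>" for S \<beta>
  proof -
    have "\<beta> \<in> C1" using that N by blast
    then show ?thesis using that unfolding C1_iff by blast
  qed
  ultimately show ?thesis unfolding C1_iff by (metis UnionE)
qed

section \<open>Tight sets are nested\<close>

definition tight_chains :: "nat \<Rightarrow> real ^ 'm::finite \<Rightarrow> 'm set set set" where
  "tight_chains n x = {\<beta> \<in> B1 n. (\<Sum>S\<in>\<beta>. excess n x S) = 3 ^ card \<beta>}"

lemma PA_iff:
  assumes "1 \<le> n"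
  shows "x \<in> PA n \<longleftrightarrow> mass x UNIV = 3 ^ (n + 1) \<and>
    (\<forall>\<beta>\<in>B1 n. 3 ^ card \<beta> \<le> (\<Sum>S\<in>\<beta>. excess n x S))"
  by (simp add: PA_eq[OF assms] chain_bound_le_iff[OF assms])

lemma singleton_in_B1:
  assumes "CARD('m::finite) = n + 1" "S \<noteq> {}" "S \<noteq> (UNIV :: 'm set)"
  shows "{S} \<in> B1 n"
proof -
  have "{S} \<in> C1" using assms by (simp add: C1_iff)
  then obtain e where e: "enumeration n e" "{S} \<subseteq> segment e 1 (n + 1)"
    using chain_in_segment[OF assms(1)] by metis
  then obtain s where s: "S = initial e s" "s \<in> {1..<n + 1}" by (auto simp: segment_def)
  then have "{S} = segment e s (s + 1)" by (simp add: segment_def)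
  then show ?thesis using enumeration.segment_in_B1[OF e(1), of s "s + 1"] s(2) by auto
qed

lemma PA_mass_ge:
  assumes "1 \<le> n" "CARD('m::finite) = n + 1" "x \<in> PA n" "S \<noteq> ({} :: 'm set)"
  shows "3 ^ card S \<le> mass x S"
proof (cases "S = UNIV")
  case True
  then show ?thesis using assms by (simp add: PA_iff)
next
  case False
  then have "{S} \<in> B1 n" using singleton_in_B1 assms by blast
  then have "3 ^ card {S} \<le> (\<Sum>S\<in>{S}. excess n x S)" using assms PA_iff by blast
  then show ?thesis using excess_ge_3_iff[OF assms(1), of x S] by simp
qed

lemma mass_modular: "mass x S + mass x T = mass x (S \<union> T) + mass x (S \<inter> T)"
  unfolding mass_def by (rule sum.union_inter[symmetric]) simp_all

text \<open>
  In a tight chain every set \<open>R\<close> has mass at most \<open>3 ^ card R + 1\<close>, because all other members already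
  contribute at least 3 to the sum of the excesses. For incomparable \<open>S\<close> and \<open>T\<close> the union, being larger
  than both, has mass at least three times the power of the larger of them, which contradicts modularity of
  the mass.
\<close>
lemma PA_tight_comparable:
  fixes x :: "real ^ 'm::finite"
  assumes n: "1 \<le> n" and card: "CARD('m) = n + 1" and x: "x \<in> PA n"
    and mem: "\<beta> \<in> tight_chains n x" "\<gamma> \<in> tight_chains n x" "S \<in> \<beta>" "T \<in> \<gamma>"
  shows "S \<subseteq> T \<or> T \<subseteq> S"
proof (rule ccontr)
  assume inc: "\<not> (S \<subseteq> T \<or> T \<subseteq> S)"
  have bound: "mass x R \<le> 3 ^ card R + 1" if \<beta>: "\<beta> \<in> tight_chains n x" and R: "R \<in> \<beta>" for \<beta> R
  proof -
    have B1: "\<beta> \<in> B1 n" and eq: "(\<Sum>S\<in>\<beta>. excess n x S) = 3 ^ card \<beta>"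
      using \<beta> by (auto simp: tight_chains_def)
    have "\<beta> \<in> C1" using B1 B1_subset_C1[OF card] by blast
    then have "3 \<le> excess n x S" if "S \<in> \<beta>" for S
      using PA_mass_ge[OF n card x, of S] that excess_ge_3_iff[OF n] by (auto simp: C1_iff)
    \<comment> \<open>All members but \<open>R\<close> take at least their share 3 of the total \<open>3 ^ card \<beta>\<close>.\<close>
    then have "(\<Sum>S\<in>\<beta> - {R}. 3) \<le> (\<Sum>S\<in>\<beta> - {R}. excess n x S)" by (intro sum_mono) auto
    moreover have "(\<Sum>S\<in>\<beta> - {R}. 3) = 3 * real (card \<beta>) - (3::real)"
      using card_B1(1)[OF B1] R by (simp add: card_Diff_singleton of_nat_diff)
    moreover have "(\<Sum>S\<in>\<beta>. excess n x S) = excess n x R + (\<Sum>S\<in>\<beta> - {R}. excess n x S)"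
      using R by (intro sum.remove) simp_all
    ultimately have "excess n x R \<le> 3 ^ card \<beta> - 3 * real (card \<beta>) + 3" using eq by linarith
    also have "\<dots> \<le> gap n + 3" using power3_le_gap card_B1[OF B1] by simp
    finally show ?thesis by (simp add: excess_le_iff[OF n])
  qed
  have "S \<noteq> {}" "T \<noteq> {}" using inc by auto
  have "0 \<le> x $ v" for v
  proof -
    have "3 ^ card {v} \<le> mass x {v}" by (rule PA_mass_ge[OF n card x]) simp
    then show ?thesis by (simp add: mass_def)
  qed
  then have "0 \<le> mass x (S \<inter> T)" unfolding mass_def by (intro sum_nonneg) simp
  moreover have "3 ^ card (S \<union> T) \<le> mass x (S \<union> T)"
    using \<open>S \<noteq> {}\<close> by (intro PA_mass_ge[OF n card x]) simp
  ultimately have "3 ^ card (S \<union> T) \<le> (3 ^ card S + 1) + (3 ^ card T + (1::real))"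
    using mass_modular[of x S T] bound[OF mem(1,3)] bound[OF mem(2,4)] by linarith
  moreover have "(3::real) ^ card S + 3 ^ card T + 3 ^ max (card S) (card T) \<le> 3 ^ card (S \<union> T)"
    using inc by (intro power3_superadditive psubset_card_mono) auto
  moreover have "(3::real) ^ 1 \<le> 3 ^ max (card S) (card T)"
    using \<open>S \<noteq> {}\<close> by (intro power_increasing) (simp_all add: Suc_le_eq card_gt_0_iff le_max_iff_disj)
  ultimately show False by simp
qed

text \<open>
  All sets in the tight chains belong to one flag. If two tight intervals overlap or are adjacent, adding
  their equations gives the sums over union and intersection, and the demand of the union alone is already
  larger than the sum of the two given demands.
\<close>
lemma tight_chains_nested:
  fixes x :: "real ^ 'm::finite"
  assumes n: "1 \<le> n" and card: "CARD('m) = n + 1" and x: "x \<in> PA n"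
  shows "tight_chains n x \<in> C n"
proof -
  define N where "N = tight_chains n x"
  have N: "N \<subseteq> B1 n" by (auto simp: N_def tight_chains_def)
  have "S \<noteq> {} \<and> S \<noteq> UNIV" if "\<beta> \<in> N" "S \<in> \<beta>" for S \<beta>
  proof -
    have "\<beta> \<in> C1" using that N B1_subset_C1[OF card] by blast
    then show ?thesis using that unfolding C1_iff by blast
  qed
  moreover have "S \<subseteq> T \<or> T \<subseteq> S" if "\<beta> \<in> N" "\<gamma> \<in> N" "S \<in> \<beta>" "T \<in> \<gamma>" for S T \<beta> \<gamma>
    using that unfolding N_def by (rule PA_tight_comparable[OF assms])
  ultimately have "\<Union>N \<in> C1" unfolding C1_iff by (metis UnionE)
  then obtain e where "enumeration n e" and flag: "\<Union>N \<subseteq> segment e 1 (n + 1)"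
    using chain_in_segment[OF card] by metis
  then interpret enumeration n e by simp
  define E where "E s = excess n x (initial e s)" for s
  have ge: "3 ^ (d - c) \<le> sum E {c..<d}" if "1 \<le> c" "c < d" "d \<le> n + 1" for c d
  proof -
    have "3 ^ card (segment e c d) \<le> (\<Sum>S\<in>segment e c d. excess n x S)"
      using segment_in_B1[OF that] x PA_iff[OF n] by blast
    then show ?thesis using that by (simp add: card_segment sum_segment E_def)
  qed
  have eq: "sum E {c..<d} = 3 ^ (d - c)" if "segment e c d \<in> N" "d \<le> n + 1" for c d
    using that by (simp add: N_def tight_chains_def card_segment sum_segment E_def)
  have "separated (\<lambda>c d. 1 \<le> c \<and> d \<le> n + 1 \<and> segment e c d \<in> N)"
    unfolding separated_def
  proof (intro allI impI notI)
    fix c d c' d'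
    assume cd: "c < c'" "c' \<le> d" "d < d'"
      and T: "(1 \<le> c \<and> d \<le> n + 1 \<and> segment e c d \<in> N) \<and>
        (1 \<le> c' \<and> d' \<le> n + 1 \<and> segment e c' d' \<in> N)"
    \<comment> \<open>The intersection is empty when the intervals are adjacent, and then its sum is zero.\<close>
    have "0 \<le> sum E {c'..<d}"
    proof (cases "c' < d")
      case True
      have "0 \<le> (3::real) ^ (d - c')" by simp
      also have "\<dots> \<le> sum E {c'..<d}" using True T by (intro ge) auto
      finally show ?thesis .
    qed simp
    moreover have "3 ^ (d' - c) \<le> sum E {c..<d'}" using cd T by (intro ge) auto
    moreover have "sum E {c..<d} = 3 ^ (d - c)" "sum E {c'..<d'} = 3 ^ (d' - c')"
      using T by (auto intro: eq)
    moreover have "sum E {c..<d'} = sum E {c..<d} + sum E {d..<d'}"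
      "sum E {c'..<d'} = sum E {c'..<d} + sum E {d..<d'}"
      using cd by (simp_all add: sum.atLeastLessThan_concat)
    moreover have "(3::real) ^ (d - c) + 3 ^ (d' - c') < 3 ^ (d' - c)"
      using cd by (intro power3_superadditive_strict) auto
    ultimately show False by linarith
  qed
  then have "nested C1 (B1 n) N" using nested_iff_separated[OF N flag] by blast
  then show ?thesis by (simp add: C_def N_def)
qed


section \<open>Nested sets are tight sets\<close>

lemma (in enumeration) exists_point_with_prefix_masses:
  assumes "y 0 = 0"
  shows "\<exists>x :: real ^ 'm. (\<forall>s\<le>n + 1. mass x (initial e s) = y s) \<and>
    (\<forall>s\<le>n. x $ e s = y (Suc s) - y s)"
proof -
  have inj: "inj_on e {..<n + 1}" and range: "e ` {..<n + 1} = UNIV"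
    using bij by (auto simp: bij_betw_def)
  define x :: "real ^ 'm" where
    "x = (\<chi> v. y (Suc (inv_into {..<n + 1} e v)) - y (inv_into {..<n + 1} e v))"
  have x: "x $ e s = y (Suc s) - y s" if "s \<le> n" for s
  proof -
    have "inv_into {..<n + 1} e (e s) = s" using that by (intro inv_into_f_f inj) simp
    then show ?thesis by (simp only: x_def vec_lambda_beta)
  qed
  have "mass x (initial e s) = y s" if s: "s \<le> n + 1" for s
  proof -
    have "mass x (initial e s) = (\<Sum>t<s. x $ e t)"
      unfolding mass_def initial_def
      by (subst sum.reindex) (use inj s in \<open>auto intro: inj_on_subset\<close>)
    also have "\<dots> = (\<Sum>t<s. y (Suc t) - y t)" using s by (intro sum.cong) (auto simp: x)
    also have "\<dots> = y s" by (simp add: sum_lessThan_telescope assms)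
    finally show ?thesis .
  qed
  then show ?thesis using x by blast
qed

text \<open>
  Choose a flag containing all sets that occur in \<open>N\<close>, and prescribe as excesses along this flag the
  weights from \<open>nested_intervals_weights\<close>; this determines \<open>x\<close> and settles all chains inside the flag.
  Since the weights are at most \<open>gap n + 3\<close>, the coordinate at position \<open>s\<close> of the flag is at least
  \<open>2 * 3 ^ s - 1\<close>. With positions counted from 0, a set outside the flag contains an element at a position not
  below its size, so it is so heavy that every chain through it satisfies its inequality strictly.
\<close>
lemma nested_tight_chains:
  fixes N :: "'m::finite set set set"
  assumes n: "1 \<le> n" and card: "CARD('m) = n + 1" and "N \<in> C n"
  shows "\<exists>x\<in>PA n. tight_chains n x = N"
proof -
  have nested: "nested C1 (B1 n) N" and N: "N \<subseteq> B1 n"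
    using assms(3) by (auto simp: C_def nested_def)
  obtain e where "enumeration n e" and flag: "\<Union>N \<subseteq> segment e 1 (n + 1)"
    using chain_in_segment[OF card Union_nested_in_C1[OF card nested]] by metis
  then interpret enumeration n e by simp
  define T where "T c d \<longleftrightarrow> 1 \<le> c \<and> d \<le> n + 1 \<and> segment e c d \<in> N" for c d
  have "separated T"
    using nested nested_iff_separated[OF N flag] by (simp add: T_def[abs_def])
  then obtain h where h: "fits T h 1 (n + 1)" using nested_intervals_weights by blast
  have h_interval: "3 ^ (d - c) \<le> sum h {c..<d}" "sum h {c..<d} = 3 ^ (d - c) \<longleftrightarrow> T c d"
    if "1 \<le> c" "c < d" "d \<le> n + 1" for c d
    using h that by (auto simp: fits_def)
  have h_ge: "3 \<le> h s" if "1 \<le> s" "s \<le> n" for s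
    using h_interval(1)[of s "s + 1"] that by simp
  have h_le: "h s \<le> gap n + 3" if s: "1 \<le> s" "s \<le> n" for s
  proof -
    \<comment> \<open>The other \<open>n - 1\<close> weights take at least 3 each from the total.\<close>
    have "sum h {1..<n + 1} \<le> 3 ^ n + 1"
      using h n by (simp add: fits_def weight_def)
    moreover have "sum h {1..<n + 1} = h s + sum h ({1..<n + 1} - {s})"
      using s by (intro sum.remove) auto
    moreover have "(\<Sum>t\<in>{1..<n + 1} - {s}. 3) \<le> sum h ({1..<n + 1} - {s})"
      using h_ge by (intro sum_mono) auto
    moreover have "(\<Sum>t\<in>{1..<n + 1} - {s}. 3) = 3 * (real n - 1)"
      using s n by (simp add: card_Diff_singleton of_nat_diff)
    ultimately have "h s \<le> 3 ^ n + 1 - 3 * (real n - 1)" by linarith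
    also have "\<dots> \<le> gap n + 3" using n by (simp add: gap_def)
    finally show ?thesis .
  qed
  \<comment> \<open>\<open>g s\<close> is the amount by which the mass of the \<open>s\<close>-th set of the flag exceeds \<open>3 ^ s\<close>.\<close>
  define g where "g s = (h s - 3) / gap n" for s
  have gap: "0 < gap n" using n by (rule gap_pos)
  have g: "0 \<le> g s" "g s \<le> 1" if "1 \<le> s" "s \<le> n" for s
    using h_ge[OF that] h_le[OF that] gap by (simp_all add: g_def)
  define y where "y s = (if s = 0 then 0 else if s = n + 1 then 3 ^ (n + 1) else 3 ^ s + g s)" for s
  obtain x :: "real ^ 'm" where mass: "\<And>s. s \<le> n + 1 \<Longrightarrow> mass x (initial e s) = y s"
    and coord: "\<And>s. s \<le> n \<Longrightarrow> x $ e s = y (Suc s) - y s"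
    using exists_point_with_prefix_masses[of y] by (auto simp: y_def)
  have excess: "excess n x (initial e s) = h s" if "1 \<le> s" "s \<le> n" for s
    using that gap by (simp add: excess_def mass card_initial y_def g_def)
  have y_bounds: "3 ^ s \<le> y s" "y s \<le> 3 ^ s + 1" if "1 \<le> s" "s \<le> n + 1" for s
    using g[of s] that by (auto simp: y_def)
  have coord_ge: "2 * 3 ^ s - 1 \<le> x $ e s" if "s \<le> n" for s
  proof (cases "s = 0")
    case True
    then show ?thesis using coord[of 0] y_bounds(1)[of 1] n by (simp add: y_def)
  next
    case False
    then show ?thesis using coord[OF that] y_bounds(1)[of "Suc s"] y_bounds(2)[of s] that by simp
  qed
  have x_nonneg: "0 \<le> x $ v" for v
  proof -
    obtain s where s: "v = e s" "s \<le> n" using bij by (force simp: bij_betw_def)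
    have "(1::real) \<le> 3 ^ s" by simp
    then show ?thesis unfolding s(1) using coord_ge[OF s(2)] by linarith
  qed
  have off_flag: "gap n + 3 < excess n x S" if S: "S \<noteq> {}" "S \<noteq> UNIV" "S \<notin> segment e 1 (n + 1)" for S
  proof -
    define s where "s = card S"
    have "card S < card (UNIV :: 'm set)" using S(2) by (intro psubset_card_mono) auto
    then have s: "1 \<le> s" "s \<le> n"
      using S(1) card by (auto simp: s_def Suc_le_eq card_gt_0_iff)
    have "\<not> S \<subseteq> initial e s"
    proof
      assume "S \<subseteq> initial e s"
      then have "S = initial e s" using s by (intro card_subset_eq) (simp_all add: s_def card_initial)
      then show False using S(3) s by (auto simp: segment_def)
    qed
    then obtain v where v: "v \<in> S" "v \<notin> initial e s" by blast
    obtain r where r: "v = e r" "r \<le> n" using bij by (force simp: bij_betw_def)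
    have "s \<le> r" using v r by (force simp: initial_def)
    then have "(3::real) ^ s \<le> 3 ^ r" by simp
    then have "2 * 3 ^ s - 1 \<le> x $ v" unfolding r(1) using coord_ge[OF r(2)] by linarith
    also have "x $ v \<le> mass x S"
      unfolding mass_def using v x_nonneg by (intro member_le_sum) auto
    finally have "2 * 3 ^ s - 1 \<le> mass x S" .
    moreover have "(3::real) ^ 1 \<le> 3 ^ s" using s by (intro power_increasing) auto
    ultimately have "\<not> mass x S \<le> 3 ^ card S + 1" by (simp add: s_def)
    then show ?thesis using excess_le_iff[OF n, of x S] by simp
  qed
  have key: "3 ^ card \<beta> \<le> (\<Sum>S\<in>\<beta>. excess n x S) \<and>
      ((\<Sum>S\<in>\<beta>. excess n x S) = 3 ^ card \<beta> \<longleftrightarrow> \<beta> \<in> N)" if \<beta>: "\<beta> \<in> B1 n" for \<beta>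
  proof (cases "\<beta> \<subseteq> segment e 1 (n + 1)")
    case True
    then obtain c d where cd: "1 \<le> c" "c < d" "d \<le> n + 1" "\<beta> = segment e c d"
      using B1_segment[OF \<beta>] by metis
    have "(\<Sum>S\<in>\<beta>. excess n x S) = sum h {c..<d}"
      using cd by (auto simp: sum_segment excess intro!: sum.cong)
    moreover have "card \<beta> = d - c" using cd by (simp add: card_segment)
    ultimately show ?thesis using h_interval[of c d] cd by (simp add: T_def)
  next
    case False
    then obtain S where S: "S \<in> \<beta>" "S \<notin> segment e 1 (n + 1)" by blast
    have proper: "R \<noteq> {} \<and> R \<noteq> UNIV" if "R \<in> \<beta>" for R
      using that subsetD[OF B1_subset_C1[OF card] \<beta>] by (auto simp: C1_iff)
    have ge3: "3 \<le> excess n x R" if R: "R \<in> \<beta>" for R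
    proof (cases "R \<in> segment e 1 (n + 1)")
      case True
      then obtain s where "R = initial e s" "1 \<le> s" "s \<le> n" by (auto simp: segment_def)
      then show ?thesis using excess h_ge by simp
    next
      case False
      then show ?thesis using off_flag[of R] proper[OF R] gap by simp
    qed
    have "3 ^ card \<beta> \<le> gap n + 3 * real (card \<beta>)"
      using power3_le_gap[of "card \<beta>" n] card_B1[OF \<beta>] by simp
    also have "\<dots> = (gap n + 3) + (\<Sum>R\<in>\<beta> - {S}. 3)"
      using S card_B1(1)[OF \<beta>] by (simp add: card_Diff_singleton of_nat_diff)
    also have "\<dots> < excess n x S + (\<Sum>R\<in>\<beta> - {S}. excess n x R)"
      using S off_flag proper ge3 by (intro add_less_le_mono sum_mono) auto
    also have "\<dots> = (\<Sum>R\<in>\<beta>. excess n x R)"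
      using S by (intro sum.remove[symmetric]) simp_all
    finally show ?thesis using False flag by auto
  qed
  have "mass x UNIV = 3 ^ (n + 1)"
    using mass[of "n + 1"] initial_Suc_n by (simp add: y_def)
  then have "x \<in> PA n" using key by (simp add: PA_iff[OF n])
  moreover have "tight_chains n x = N" using key N by (auto simp: tight_chains_def)
  ultimately show ?thesis by blast
qed


section \<open>The permutoassociahedron\<close>

lemma bounded_PA:
  assumes "1 \<le> n" "CARD('m::finite) = n + 1"
  shows "bounded (PA n :: (real ^ 'm) set)"
proof -
  have "PA n \<subseteq> cbox (0 :: real ^ 'm) (\<chi> v. 3 ^ (n + 1))"
  proof
    fix x :: "real ^ 'm" assume x: "x \<in> PA n"
    have nonneg: "0 \<le> x $ v" for v
    proof -
      have "3 ^ card {v} \<le> mass x {v}" by (rule PA_mass_ge[OF assms x]) simp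
      then show ?thesis by (simp add: mass_def)
    qed
    moreover have "x $ v \<le> 3 ^ (n + 1)" for v
    proof -
      have "x $ v \<le> mass x UNIV"
        unfolding mass_def by (rule member_le_sum) (use nonneg in auto)
      then show ?thesis using x assms(1) by (simp add: PA_iff)
    qed
    ultimately show "x \<in> cbox 0 (\<chi> v. 3 ^ (n + 1))" by (simp add: mem_box_cart)
  qed
  then show ?thesis using bounded_cbox bounded_subset by blast
qed

theorem theorem5p2:
  fixes n :: nat
  assumes "n \<ge> 1" and "CARD('m::finite) = n + 1"
  shows "simple_polytope (PA n :: (real ^ 'm) set) \<and>
    aff_dim (PA n :: (real ^ 'm) set) = int n \<and>
    realises (PA n :: (real ^ 'm) set) (C n :: 'm set set set set)"
proof -
  define H :: "(real ^ 'm) set" where "H = {x. (\<chi> v. 1) \<bullet> x = 3 ^ (n + 1)}"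
  have H: "x \<in> H \<longleftrightarrow> mass x UNIV = 3 ^ (n + 1)" for x
    by (simp add: H_def inner_vec_def mass_def)
  interpret inequality_system "B1 n :: 'm set set set" chain_normal "chain_bound n" H
    by standard (simp_all add: H_def affine_hyperplane)
  have P: "P = (PA n :: (real ^ 'm) set)"
    by (auto simp: P_def PA_eq[OF assms(1)] H)
  have tight: "tight = (tight_chains n :: real ^ 'm \<Rightarrow> _)"
    by (auto simp: fun_eq_iff tight_def tight_chains_def chain_bound_eq_iff[OF assms(1)])
  have C: "tight ` P = (C n :: 'm set set set set)"
    unfolding P tight
    using tight_chains_nested[OF assms] nested_tight_chains[OF assms] by blast
  have down: "M \<in> tight ` P" if "N \<in> tight ` P" "M \<subseteq> N" for M N :: "'m set set set"
    using that unfolding C by (auto simp: C_def nested_def antichain_in_def)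
  have "({} :: 'm set set set) \<in> C n"
    by (auto simp: C_def nested_def antichain_in_def)
  then have "aff_dim P = aff_dim H" by (intro aff_dim_P) (simp only: C)
  also have "\<dots> = int n"
    unfolding H_def using assms(2) by (subst aff_dim_hyperplane) (auto simp: vec_eq_iff)
  finally have "aff_dim P = int n" .
  moreover have "simple_polytope P"
    using down bounded_PA[OF assms] by (intro simple_polytope_P) (simp_all only: P)
  moreover have "realises P (C n :: 'm set set set set)" using realises_tight by (simp only: C)
  ultimately show ?thesis by (simp add: P)
qed

end
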